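(* Let $E$ be an input type and $S$ an output type of system $\mathcal F$ such that the type constant $\perp$ does not occur in $S$. If $T$ is a closed $\lambda$-term with $\vdash_{\mathcal F} T : E^* \rightarrow \neg\neg S$, then $T$ is a storage operator for the pair $(E,S)$: for every $\lambda$-term $t$ with $\vdash_{\mathcal F} t : E$ there exist $\lambda$-terms $\tau,\tau'$ with $\tau \simeq_\beta \tau'$ and $\vdash_{\mathcal F}\tau' : S$ such that for every $\lambda$-term $\theta_t \simeq_\beta t$ there is a substitution $\sigma$ (of $\lambda$-terms for term variables) with $(T)\theta_t f \succ_f (f)\sigma(\tau)$, where $f$ is a fresh variable.
   Context: $\lambda$-terms are those of the untyped $\lambda$-calculus; $\simeq_\beta$ is $\beta$-equivalence; $Fv(t)$ the free variables; normal means without $\beta$-redex. $u \succ_f v$ means that $v$ is obtained from $u$ by (finitely many steps of) weak head reduction, i.e. repeatedly reducing the redex $(\lambda x u)v$ in a term of the form $(\lambda x u)v v_1\dots v_m$. Types of system $\mathcal F$ are built from type variables and type constants (atomic, not quantifiable; in particular $O$ and $\perp$, distinct) with $\rightarrow$, $\forall$; only proper types (in every $\forall XA$, $X$ occurs free in $A$). Typing: (ax) $\Gamma \vdash x_i : A_i$ for $x_i:A_i\in\Gamma$; ($\rightarrow_i$) from $\Gamma, x:B \vdash t : C$ infer $\Gamma \vdash \lambda x t : B \rightarrow C$; ($\rightarrow_e$) from $\Gamma \vdash u : B\rightarrow C$, $\Gamma \vdash v : B$ infer $\Gamma \vdash (u)v : C$; ($\forall_i$) from $\Gamma \vdash t :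 A$, $X$ not free in $\Gamma$, infer $\Gamma \vdash t : \forall X A$; ($\forall_e$) from $\Gamma \vdash t : \forall X A$ infer $\Gamma \vdash t : A[C/X]$. $\mathcal F_0$ is $\mathcal F$ without ($\forall_e$). An input type is a closed type $E$ such that for every normal $t$, $\vdash_{\mathcal F} t:E$ implies $\vdash_{\mathcal F_0} t:E$. An output type is a closed type $S$ not containing $O$ such that for every normal $t$ and variable $\alpha$, $\alpha:O\vdash_{\mathcal F}t:S$ implies $\alpha\notin Fv(t)$. $\neg A$ denotes $A\rightarrow\perp$, and $A^*$ (Gödel translation) is obtained from $A$ by replacing each atomic subformula $R$ by $\neg R$. *)

theory Defs
  imports Main
begin

datatype dB = Var nat | App dB dB | Abs dB

primrec lift :: "dB \<Rightarrow> nat \<Rightarrow> dB" where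
  "lift (Var i) k = (if i < k then Var i else Var (Suc i))"
| "lift (App s t) k = App (lift s k) (lift t k)"
| "lift (Abs s) k = Abs (lift s (Suc k))"

primrec subst :: "dB \<Rightarrow> dB \<Rightarrow> nat \<Rightarrow> dB" where
  "subst (Var i) s k = (if k < i then Var (i - 1) else if i = k then s else Var i)"
| "subst (App t u) s k = App (subst t s k) (subst u s k)"
| "subst (Abs t) s k = Abs (subst t (lift s 0) (Suc k))"

primrec frees :: "dB \<Rightarrow> nat set" where
  "frees (Var i) = {i}"
| "frees (App s t) = frees s \<union> frees t"
| "frees (Abs t) = {i. Suc i \<in> frees t}"

definition closed_term :: "dB \<Rightarrow> bool" where
  "closed_term t \<longleftrightarrow> frees t = {}"

primrec psubst :: "(nat \<Rightarrow> dB) \<Rightarrow> dB \<Rightarrow> dB" where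
  "psubst \<sigma> (Var i) = \<sigma> i"
| "psubst \<sigma> (App s t) = App (psubst \<sigma> s) (psubst \<sigma> t)"
| "psubst \<sigma> (Abs t) = Abs (psubst (\<lambda>i. if i = 0 then Var 0 else lift (\<sigma> (i - 1)) 0) t)"

inductive beta :: "dB \<Rightarrow> dB \<Rightarrow> bool" where
  beta_redex: "beta (App (Abs s) t) (subst s t 0)"
| beta_appL: "beta s t \<Longrightarrow> beta (App s u) (App t u)"
| beta_appR: "beta s t \<Longrightarrow> beta (App u s) (App u t)"
| beta_abs: "beta s t \<Longrightarrow> beta (Abs s) (Abs t)"

definition beta_eq :: "dB \<Rightarrow> dB \<Rightarrow> bool" where
  "beta_eq = equivclp beta"

primrec has_redex :: "dB \<Rightarrow> bool" where
  "has_redex (Var i) = False"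
| "has_redex (App s t) = ((\<exists>u. s = Abs u) \<or> has_redex s \<or> has_redex t)"
| "has_redex (Abs t) = has_redex t"

definition normal :: "dB \<Rightarrow> bool" where
  "normal t \<longleftrightarrow> \<not> has_redex t"

inductive whr :: "dB \<Rightarrow> dB \<Rightarrow> bool" where
  whr_redex: "whr (App (Abs u) v) (subst u v 0)"
| whr_app: "whr s s' \<Longrightarrow> whr (App s t) (App s' t)"

definition whr_star :: "dB \<Rightarrow> dB \<Rightarrow> bool" where
  "whr_star = whr\<^sup>*\<^sup>*"

datatype ty = TVar nat | TCon nat | Arrow ty ty | All ty

definition tyO :: ty where "tyO = TCon 0"
definition tyBot :: ty where "tyBot = TCon 1"

primrec ftv :: "ty \<Rightarrow> nat set" where
  "ftv (TVar i) = {i}"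
| "ftv (TCon c) = {}"
| "ftv (Arrow A B) = ftv A \<union> ftv B"
| "ftv (All A) = {i. Suc i \<in> ftv A}"

primrec tcons :: "ty \<Rightarrow> nat set" where
  "tcons (TVar i) = {}"
| "tcons (TCon c) = {c}"
| "tcons (Arrow A B) = tcons A \<union> tcons B"
| "tcons (All A) = tcons A"

primrec proper :: "ty \<Rightarrow> bool" where
  "proper (TVar i) = True"
| "proper (TCon c) = True"
| "proper (Arrow A B) = (proper A \<and> proper B)"
| "proper (All A) = (0 \<in> ftv A \<and> proper A)"

definition closed_ty :: "ty \<Rightarrow> bool" where
  "closed_ty A \<longleftrightarrow> ftv A = {}"

primrec lift_ty :: "ty \<Rightarrow> nat \<Rightarrow> ty" where
  "lift_ty (TVar i) k = (if i < k then TVar i else TVar (Suc i))"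
| "lift_ty (TCon c) k = TCon c"
| "lift_ty (Arrow A B) k = Arrow (lift_ty A k) (lift_ty B k)"
| "lift_ty (All A) k = All (lift_ty A (Suc k))"

primrec subst_ty :: "ty \<Rightarrow> ty \<Rightarrow> nat \<Rightarrow> ty" where
  "subst_ty (TVar i) C k = (if k < i then TVar (i - 1) else if i = k then C else TVar i)"
| "subst_ty (TCon c) C k = TCon c"
| "subst_ty (Arrow A B) C k = Arrow (subst_ty A C k) (subst_ty B C k)"
| "subst_ty (All A) C k = All (subst_ty A (lift_ty C 0) (Suc k))"

definition neg :: "ty \<Rightarrow> ty" where
  "neg A = Arrow A tyBot"

primrec goedel :: "ty \<Rightarrow> ty" where
  "goedel (TVar i) = neg (TVar i)"
| "goedel (TCon c) = neg (TCon c)"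
| "goedel (Arrow A B) = Arrow (goedel A) (goedel B)"
| "goedel (All A) = All (goedel A)"

text \<open>Typing. The flag b says whether the rule (\<forall>e) is allowed:
  typing True is system F, typing False is system F0.
  The context is a list: de Bruijn variable i has type \<Gamma> ! i.
  Side conditions keep all types proper.\<close>
inductive typing :: "bool \<Rightarrow> ty list \<Rightarrow> dB \<Rightarrow> ty \<Rightarrow> bool" where
  ax: "i < length \<Gamma> \<Longrightarrow> typing b \<Gamma> (Var i) (\<Gamma> ! i)"
| arr_i: "proper B \<Longrightarrow> typing b (B # \<Gamma>) t C \<Longrightarrow> typing b \<Gamma> (Abs t) (Arrow B C)"
| arr_e: "typing b \<Gamma> u (Arrow B C) \<Longrightarrow> typing b \<Gamma> v B \<Longrightarrow> typing b \<Gamma> (App u v) C"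
| all_i: "0 \<in> ftv A \<Longrightarrow> typing b (map (\<lambda>B. lift_ty B 0) \<Gamma>) t A \<Longrightarrow> typing b \<Gamma> t (All A)"
| all_e: "b \<Longrightarrow> proper C \<Longrightarrow> typing b \<Gamma> t (All A) \<Longrightarrow> typing b \<Gamma> t (subst_ty A C 0)"

abbreviation typF :: "ty list \<Rightarrow> dB \<Rightarrow> ty \<Rightarrow> bool" where
  "typF \<equiv> typing True"
abbreviation typF0 :: "ty list \<Rightarrow> dB \<Rightarrow> ty \<Rightarrow> bool" where
  "typF0 \<equiv> typing False"

definition input_type :: "ty \<Rightarrow> bool" where
  "input_type E \<longleftrightarrow> closed_ty E \<and> proper E \<and>
     (\<forall>t. normal t \<longrightarrow> typF [] t E \<longrightarrow> typF0 [] t E)"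

text \<open>The context alpha:O is the one-element list [O]; alpha is Var 0.\<close>
definition output_type :: "ty \<Rightarrow> bool" where
  "output_type S \<longleftrightarrow> closed_ty S \<and> proper S \<and> 0 \<notin> tcons S \<and>
     (\<forall>t. normal t \<longrightarrow> typF [tyO] t S \<longrightarrow> 0 \<notin> frees t)"

definition storage_operator :: "dB \<Rightarrow> ty \<Rightarrow> ty \<Rightarrow> bool" where
  "storage_operator T E S \<longleftrightarrow>
     (\<forall>t. typF [] t E \<longrightarrow>
       (\<exists>\<tau> \<tau>'. beta_eq \<tau> \<tau>' \<and> typF [] \<tau>' S \<and>
         (\<forall>\<theta> f. beta_eq \<theta> t \<longrightarrow> f \<notin> frees T \<longrightarrow> f \<notin> frees \<theta> \<longrightarrow>
            (\<exists>\<sigma>. whr_star (App (App T \<theta>) (Var f)) (App (Var f) (psubst \<sigma> \<tau>))))))"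

end

theory Submission
  imports Defs "HOL-Library.Confluence"
begin

text \<open>Let \<open>t\<^sub>0\<close> be the normal form of \<open>t\<close>. Since \<open>E\<close> is an input type, \<open>t\<^sub>0 : E\<close> is derivable without
  \<open>\<forall>\<close>-elimination, so the typings of its subterms survive the Goedel translation. Run the
  weak head reduction of \<open>T x f\<close> with a variable \<open>x : E\<^sup>*\<close> in place of \<open>\<theta>\<close>. Every state has type \<open>\<bottom>\<close>, so when
  a variable standing for a subterm of \<open>t\<^sub>0\<close> comes to the head it has received enough arguments to be
  replaced by its body, whose own argument subterms are again frozen as fresh variables. By
  standardization, any \<open>\<theta> \<simeq>\<^sub>\<beta> t\<^sub>0\<close> follows the same run up to the values of these variables, and the run
  terminates because \<open>T t\<^sub>0 f\<close> is normalizable. It ends in \<open>f \<tau>\<close> with \<open>\<tau> : S\<close> in a context of variables of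
  type \<open>B\<^sup>*\<close>. Replacing \<open>\<bottom>\<close> by \<open>O\<close>, these types are inhabited by \<open>\<lambda>x\<^sub>1\<dots>x\<^sub>r. \<alpha>\<close> with \<open>\<alpha> : O\<close>; as \<open>S\<close> is an output type,
  \<open>\<alpha>\<close> disappears from the normal form, so the normal form \<open>\<tau>'\<close> of \<open>\<tau>\<close> is closed.\<close>

subsection \<open>Simultaneous substitution\<close>

abbreviation up :: "(nat \<Rightarrow> dB) \<Rightarrow> nat \<Rightarrow> dB" where
  "up \<sigma> \<equiv> case_nat (Var 0) (\<lambda>j. lift (\<sigma> j) 0)"

text \<open>The \<open>case_nat\<close> form replaces the defining equation as simp rule, so that
  \<open>up\<close> combines with environments \<open>case_nat a \<sigma>\<close>, the form in which
  contracted redexes appear below.\<close>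

lemma psubst_Abs [simp]: "psubst \<sigma> (Abs t) = Abs (psubst (up \<sigma>) t)"
proof -
  have "(\<lambda>i. if i = 0 then Var 0 else lift (\<sigma> (i - 1)) 0) = up \<sigma>"
    by (auto split: nat.split)
  then show ?thesis by simp
qed

declare psubst.simps(3) [simp del]

lemma psubst_cong: "(\<And>i. i \<in> frees t \<Longrightarrow> \<sigma> i = \<sigma>' i) \<Longrightarrow> psubst \<sigma> t = psubst \<sigma>' t"
proof (induction t arbitrary: \<sigma> \<sigma>')
  case (App s t)
  have "psubst \<sigma> s = psubst \<sigma>' s" "psubst \<sigma> t = psubst \<sigma>' t"
    by (rule App.IH; simp add: App.prems)+
  then show ?case by simp
next
  case (Abs t)
  have "psubst (up \<sigma>) t = psubst (up \<sigma>') t"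
    by (rule Abs.IH) (use Abs.prems in \<open>auto split: nat.split\<close>)
  then show ?case by simp
qed simp

lemma psubst_Var [simp]: "psubst Var t = t"
proof (induction t)
  case (Abs t)
  have "up Var = Var" by (auto split: nat.split)
  with Abs show ?case by simp
qed auto

lemma lift_psubst: "lift t k = psubst (\<lambda>i. if i < k then Var i else Var (Suc i)) t"
proof (induction t arbitrary: k)
  case (Abs t)
  have "up (\<lambda>i. if i < k then Var i else Var (Suc i)) = (\<lambda>i. if i < Suc k then Var i else Var (Suc i))"
    by (auto split: nat.split)
  with Abs show ?case by simp
qed auto

lemma lift_0: "lift t 0 = psubst (\<lambda>i. Var (Suc i)) t"
  by (simp add: lift_psubst)

lemma subst_psubst:
  "subst t s k = psubst (\<lambda>i. if k < i then Var (i - 1) else if i = k then s else Var i) t"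
proof (induction t arbitrary: s k)
  case (Abs t)
  have "up (\<lambda>i. if k < i then Var (i - 1) else if i = k then s else Var i)
      = (\<lambda>i. if Suc k < i then Var (i - 1) else if i = Suc k then lift s 0 else Var i)"
    by (auto split: nat.split)
  with Abs show ?case by simp
qed auto

lemma subst_0: "subst t s 0 = psubst (case_nat s Var) t"
proof -
  have "(\<lambda>i. if 0 < i then Var (i - 1) else if i = 0 then s else Var i) = case_nat s Var"
    by (auto split: nat.split)
  then show ?thesis by (simp add: subst_psubst)
qed

text \<open>Renamings come first: composing substitutions under a binder requires commuting them
  with \<open>lift\<close>, which is itself a renaming.\<close>

lemma psubst_rename: "psubst \<sigma> (psubst (\<lambda>i. Var (\<xi> i)) t) = psubst (\<lambda>i. \<sigma> (\<xi> i)) t"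
proof (induction t arbitrary: \<sigma> \<xi>)
  case (Abs t)
  have "up (\<lambda>i. Var (\<xi> i)) = (\<lambda>i. Var (case_nat 0 (\<lambda>j. Suc (\<xi> j)) i))"
    by (auto split: nat.split)
  moreover have "(\<lambda>i. up \<sigma> (case_nat 0 (\<lambda>j. Suc (\<xi> j)) i)) = up (\<lambda>i. \<sigma> (\<xi> i))"
    by (auto split: nat.split)
  ultimately show ?case by (simp add: Abs)
qed auto

lemma rename_psubst:
  "psubst (\<lambda>i. Var (\<xi> i)) (psubst \<sigma> t) = psubst (\<lambda>i. psubst (\<lambda>i. Var (\<xi> i)) (\<sigma> i)) t"
proof (induction t arbitrary: \<sigma> \<xi>)
  case (Abs t)
  have *: "up (\<lambda>i. Var (\<xi> i)) = (\<lambda>i. Var (case_nat 0 (\<lambda>j. Suc (\<xi> j)) i))"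
    by (auto split: nat.split)
  have "(\<lambda>i. psubst (\<lambda>i. Var (case_nat 0 (\<lambda>j. Suc (\<xi> j)) i)) (up \<sigma> i))
      = up (\<lambda>i. psubst (\<lambda>i. Var (\<xi> i)) (\<sigma> i))"
    by (rule ext) (auto simp: lift_0 psubst_rename split: nat.split)
  with * show ?case by (simp add: Abs)
qed auto

lemma psubst_psubst: "psubst \<sigma> (psubst \<sigma>' t) = psubst (\<lambda>i. psubst \<sigma> (\<sigma>' i)) t"
proof (induction t arbitrary: \<sigma> \<sigma>')
  case (Abs t)
  have "(\<lambda>i. psubst (up \<sigma>) (up \<sigma>' i)) = up (\<lambda>i. psubst \<sigma> (\<sigma>' i))"
    by (rule ext) (auto simp: lift_0 psubst_rename rename_psubst split: nat.split)
  then show ?case by (simp add: Abs)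
qed auto

text \<open>Contracting a redex whose body carries the environment \<sigma> amounts to extending
  \<sigma> by the argument.\<close>

lemma subst_psubst_up: "subst (psubst (up \<sigma>) t) a 0 = psubst (case_nat a \<sigma>) t"
proof -
  have "(\<lambda>i. psubst (case_nat a Var) (up \<sigma> i)) = case_nat a \<sigma>"
    by (rule ext) (auto simp: lift_0 psubst_rename split: nat.split)
  then show ?thesis by (simp add: subst_0 psubst_psubst)
qed

lemma psubst_subst: "psubst \<sigma> (subst t a 0) = subst (psubst (up \<sigma>) t) (psubst \<sigma> a) 0"
proof -
  have "(\<lambda>i. psubst \<sigma> (case_nat a Var i)) = case_nat (psubst \<sigma> a) \<sigma>"
    by (rule ext) (auto split: nat.split)
  then show ?thesis by (simp only: subst_psubst_up) (simp add: subst_0 psubst_psubst)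
qed

lemma psubst_foldl_App:
  "psubst \<sigma> (foldl App h cs) = foldl App (psubst \<sigma> h) (map (psubst \<sigma>) cs)"
  by (induction cs arbitrary: h) auto

section \<open>Simultaneous substitution in types\<close>

abbreviation up_ty :: "(nat \<Rightarrow> ty) \<Rightarrow> nat \<Rightarrow> ty" where
  "up_ty \<rho> \<equiv> case_nat (TVar 0) (\<lambda>j. lift_ty (\<rho> j) 0)"

primrec tsubst :: "(nat \<Rightarrow> ty) \<Rightarrow> ty \<Rightarrow> ty" where
  "tsubst \<rho> (TVar i) = \<rho> i"
| "tsubst \<rho> (TCon c) = TCon c"
| "tsubst \<rho> (Arrow A B) = Arrow (tsubst \<rho> A) (tsubst \<rho> B)"
| "tsubst \<rho> (All A) = All (tsubst (up_ty \<rho>) A)"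

lemma tsubst_TVar [simp]: "tsubst TVar A = A"
proof (induction A)
  case (All A)
  have "up_ty TVar = TVar" by (auto split: nat.split)
  with All show ?case by simp
qed auto

lemma lift_ty_tsubst: "lift_ty A k = tsubst (\<lambda>i. if i < k then TVar i else TVar (Suc i)) A"
proof (induction A arbitrary: k)
  case (All A)
  have "up_ty (\<lambda>i. if i < k then TVar i else TVar (Suc i))
      = (\<lambda>i. if i < Suc k then TVar i else TVar (Suc i))"
    by (auto split: nat.split)
  with All show ?case by simp
qed auto

lemma lift_ty_0: "lift_ty A 0 = tsubst (\<lambda>i. TVar (Suc i)) A"
  by (simp add: lift_ty_tsubst)

lemma subst_ty_tsubst:
  "subst_ty A C k = tsubst (\<lambda>i. if k < i then TVar (i - 1) else if i = k then C else TVar i) A"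
proof (induction A arbitrary: C k)
  case (All A)
  have "up_ty (\<lambda>i. if k < i then TVar (i - 1) else if i = k then C else TVar i)
      = (\<lambda>i. if Suc k < i then TVar (i - 1) else if i = Suc k then lift_ty C 0 else TVar i)"
    by (auto split: nat.split)
  with All show ?case by simp
qed auto

lemma subst_ty_0: "subst_ty A C 0 = tsubst (case_nat C TVar) A"
proof -
  have "(\<lambda>i. if 0 < i then TVar (i - 1) else if i = 0 then C else TVar i) = case_nat C TVar"
    by (auto split: nat.split)
  then show ?thesis by (simp add: subst_ty_tsubst)
qed

lemma tsubst_rename: "tsubst \<rho> (tsubst (\<lambda>i. TVar (\<xi> i)) A) = tsubst (\<lambda>i. \<rho> (\<xi> i)) A"
proof (induction A arbitrary: \<rho> \<xi>)
  case (All A)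
  have "up_ty (\<lambda>i. TVar (\<xi> i)) = (\<lambda>i. TVar (case_nat 0 (\<lambda>j. Suc (\<xi> j)) i))"
    by (auto split: nat.split)
  moreover have "(\<lambda>i. up_ty \<rho> (case_nat 0 (\<lambda>j. Suc (\<xi> j)) i)) = up_ty (\<lambda>i. \<rho> (\<xi> i))"
    by (auto split: nat.split)
  ultimately show ?case by (simp add: All)
qed auto

lemma rename_tsubst:
  "tsubst (\<lambda>i. TVar (\<xi> i)) (tsubst \<rho> A) = tsubst (\<lambda>i. tsubst (\<lambda>i. TVar (\<xi> i)) (\<rho> i)) A"
proof (induction A arbitrary: \<rho> \<xi>)
  case (All A)
  have *: "up_ty (\<lambda>i. TVar (\<xi> i)) = (\<lambda>i. TVar (case_nat 0 (\<lambda>j. Suc (\<xi> j)) i))"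
    by (auto split: nat.split)
  have "(\<lambda>i. tsubst (\<lambda>i. TVar (case_nat 0 (\<lambda>j. Suc (\<xi> j)) i)) (up_ty \<rho> i))
      = up_ty (\<lambda>i. tsubst (\<lambda>i. TVar (\<xi> i)) (\<rho> i))"
    by (rule ext) (auto simp: lift_ty_0 tsubst_rename split: nat.split)
  with * show ?case by (simp add: All)
qed auto

lemma tsubst_tsubst: "tsubst \<rho> (tsubst \<rho>' A) = tsubst (\<lambda>i. tsubst \<rho> (\<rho>' i)) A"
proof (induction A arbitrary: \<rho> \<rho>')
  case (All A)
  have "(\<lambda>i. tsubst (up_ty \<rho>) (up_ty \<rho>' i)) = up_ty (\<lambda>i. tsubst \<rho> (\<rho>' i))"
    by (rule ext) (auto simp: lift_ty_0 tsubst_rename rename_tsubst split: nat.split)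
  then show ?case by (simp add: All)
qed auto

lemma tsubst_up_lift: "tsubst (up_ty \<rho>) (lift_ty A 0) = lift_ty (tsubst \<rho> A) 0"
  by (simp add: lift_ty_0 tsubst_rename rename_tsubst)

lemma tsubst_scons_lift: "tsubst (case_nat C \<rho>) (lift_ty A 0) = tsubst \<rho> A"
  by (simp add: lift_ty_0 tsubst_rename)

lemma subst_ty_up: "subst_ty (tsubst (up_ty \<rho>) A) C 0 = tsubst (case_nat C \<rho>) A"
proof -
  have "(\<lambda>i. tsubst (case_nat C TVar) (up_ty \<rho> i)) = case_nat C \<rho>"
    by (rule ext) (auto simp: tsubst_scons_lift split: nat.split)
  then show ?thesis by (simp add: subst_ty_0 tsubst_tsubst)
qed

lemma tsubst_subst_ty: "tsubst \<rho> (subst_ty A C 0) = subst_ty (tsubst (up_ty \<rho>) A) (tsubst \<rho> C) 0"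
proof -
  have "(\<lambda>i. tsubst \<rho> (case_nat C TVar i)) = case_nat (tsubst \<rho> C) \<rho>"
    by (rule ext) (auto split: nat.split)
  then show ?thesis by (simp only: subst_ty_up) (simp add: subst_ty_0 tsubst_tsubst)
qed

lemma ftv_tsubst: "ftv (tsubst \<rho> A) = (\<Union>i\<in>ftv A. ftv (\<rho> i))"
proof (induction A arbitrary: \<rho>)
  case (All A)
  have lift: "i \<in> ftv (lift_ty B k) \<longleftrightarrow> i < k \<and> i \<in> ftv B \<or> k < i \<and> i - 1 \<in> ftv B" for i B k
  proof (induction B arbitrary: i k)
    case (All B)
    show ?case by (cases i) (auto simp: All.IH)
  qed auto
  have "Suc i \<in> ftv (up_ty \<rho> j) \<longleftrightarrow> (\<exists>m. j = Suc m \<and> i \<in> ftv (\<rho> m))" for i j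
    by (auto simp: lift split: nat.split)
  then show ?case
    by (auto simp: All.IH)
qed auto

lemma proper_tsubst: "proper A \<Longrightarrow> (\<And>i. proper (\<rho> i)) \<Longrightarrow> proper (tsubst \<rho> A)"
proof (induction A arbitrary: \<rho>)
  case (All A)
  have "proper (lift_ty B k)" if "proper B" for B k
    using that
  proof (induction B arbitrary: k)
    case (All B)
    have "0 \<in> ftv (lift_ty B (Suc k))"
      unfolding lift_ty_tsubst ftv_tsubst using All.prems by (auto intro!: bexI[of _ 0])
    then show ?case using All by simp
  qed auto
  then have "proper (up_ty \<rho> i)" for i
    using All.prems(2) by (auto split: nat.split)
  moreover have "0 \<in> ftv (tsubst (up_ty \<rho>) A)"
    unfolding ftv_tsubst using All.prems by (auto intro!: bexI[of _ 0])
  ultimately show ?case using All by simp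
qed simp_all

text \<open>Commutation needs atoms to go to atoms: replacing X by a compound C gives
  \<open>goedel C\<close> on one side and \<open>neg C\<close> on the other. The translation thus
  does not respect instantiation of quantifiers, which is why a typing in F0 is wanted.\<close>

lemma goedel_tsubst_rename: "goedel (tsubst (\<lambda>i. TVar (\<xi> i)) A) = tsubst (\<lambda>i. TVar (\<xi> i)) (goedel A)"
proof (induction A arbitrary: \<xi>)
  case (All A)
  have "up_ty (\<lambda>i. TVar (\<xi> i)) = (\<lambda>i. TVar (case_nat 0 (\<lambda>j. Suc (\<xi> j)) i))"
    by (auto split: nat.split)
  then show ?case by (simp add: All)
qed (auto simp: neg_def tyBot_def)

lemma goedel_lift: "goedel (lift_ty A 0) = lift_ty (goedel A) 0"
  by (simp add: lift_ty_0 goedel_tsubst_rename)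

lemma ftv_goedel [simp]: "ftv (goedel A) = ftv A"
  by (induction A) (auto simp: neg_def tyBot_def)

lemma proper_goedel: "proper A \<Longrightarrow> proper (goedel A)"
  by (induction A) (auto simp: neg_def tyBot_def)

subsection \<open>Type preservation\<close>

lemma typing_frees: "typing b \<Gamma> t A \<Longrightarrow> i \<in> frees t \<Longrightarrow> i < length \<Gamma>"
  by (induction arbitrary: i rule: typing.induct) fastforce+

lemma typing_cong:
  assumes "typing b \<Gamma> t A" "\<And>i. i \<in> frees t \<Longrightarrow> i < length \<Gamma>' \<and> \<Gamma>' ! i = \<Gamma> ! i"
  shows "typing b \<Gamma>' t A"
  using assms
proof (induction arbitrary: \<Gamma>' rule: typing.induct)
  case (ax i \<Gamma> b)
  then show ?case using typing.ax[of i \<Gamma>' b] by simp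
next
  case (arr_i B b \<Gamma> t C)
  have "typing b (B # \<Gamma>') t C"
  proof (rule arr_i.IH)
    fix i assume "i \<in> frees t"
    then show "i < length (B # \<Gamma>') \<and> (B # \<Gamma>') ! i = (B # \<Gamma>) ! i"
      using arr_i.prems by (cases i) auto
  qed
  then show ?case using arr_i.hyps by (auto intro: typing.arr_i)
next
  case (arr_e b \<Gamma> u B C v)
  then show ?case by (auto intro!: typing.arr_e)
next
  case (all_i A b \<Gamma> t)
  have "typing b (map (\<lambda>B. lift_ty B 0) \<Gamma>') t A"
  proof (rule all_i.IH)
    fix i assume "i \<in> frees t"
    then show "i < length (map (\<lambda>B. lift_ty B 0) \<Gamma>') \<and>
        map (\<lambda>B. lift_ty B 0) \<Gamma>' ! i = map (\<lambda>B. lift_ty B 0) \<Gamma> ! i"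
      using all_i.prems all_i.hyps(2) typing_frees by (metis length_map nth_map)
  qed
  then show ?case using all_i.hyps by (auto intro: typing.all_i)
next
  case (all_e b C \<Gamma> t A)
  then show ?case by (auto intro: typing.all_e)
qed


lemma typing_append: "typing b \<Gamma> t A \<Longrightarrow> typing b (\<Gamma> @ \<Gamma>') t A"
  by (rule typing_cong) (auto dest: typing_frees simp: nth_append)

lemma typing_proper:
  "typing b \<Gamma> t A \<Longrightarrow> (\<And>B. B \<in> set \<Gamma> \<Longrightarrow> proper B) \<Longrightarrow> proper A"
proof (induction rule: typing.induct)
  case (arr_i B b \<Gamma> t C)
  then show ?case by auto
next
  case (all_i A b \<Gamma> t)
  then have "proper A" by (force simp: lift_ty_0 intro: proper_tsubst)
  then show ?case using all_i by simp
next
  case (all_e b C \<Gamma> t A)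
  then have "proper A" by simp
  then show ?case
    unfolding subst_ty_0 using all_e.hyps(2) by (auto intro!: proper_tsubst split: nat.split)
qed auto

lemma ftv_up_ty: "0 \<in> ftv A \<Longrightarrow> 0 \<in> ftv (tsubst (up_ty \<rho>) A)"
  unfolding ftv_tsubst by (auto intro!: bexI[of _ 0])

lemma map_tsubst_lift:
  "map (tsubst (up_ty \<rho>)) (map (\<lambda>B. lift_ty B 0) \<Gamma>) = map (\<lambda>B. lift_ty B 0) (map (tsubst \<rho>) \<Gamma>)"
  by (simp add: tsubst_up_lift)

lemma map_tsubst_scons_lift:
  "map (tsubst (case_nat C TVar)) (map (\<lambda>B. lift_ty B 0) \<Gamma>) = \<Gamma>"
  by (simp add: tsubst_scons_lift comp_def)

lemma typing_tsubst:
  assumes "typing b \<Gamma> t A" "\<And>i. proper (\<rho> i)"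
  shows "typing b (map (tsubst \<rho>) \<Gamma>) t (tsubst \<rho> A)"
  using assms
proof (induction arbitrary: \<rho> rule: typing.induct)
  case (ax i \<Gamma> b)
  then show ?case using typing.ax[of i "map (tsubst \<rho>) \<Gamma>" b] by simp
next
  case (arr_i B b \<Gamma> t C)
  then show ?case by (auto intro!: typing.arr_i proper_tsubst)
next
  case (arr_e b \<Gamma> u B C v)
  then show ?case by (auto intro: typing.arr_e)
next
  case (all_i A b \<Gamma> t)
  have "proper (up_ty \<rho> i)" for i
    using all_i.prems by (auto simp: lift_ty_0 intro: proper_tsubst split: nat.split)
  then have "typing b (map (tsubst (up_ty \<rho>)) (map (\<lambda>B. lift_ty B 0) \<Gamma>)) t (tsubst (up_ty \<rho>) A)"
    by (rule all_i.IH)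
  then show ?case
    unfolding map_tsubst_lift using all_i.hyps by (auto intro!: typing.all_i ftv_up_ty)
next
  case (all_e b C \<Gamma> t A)
  then have "typing b (map (tsubst \<rho>) \<Gamma>) t (All (tsubst (up_ty \<rho>) A))" by simp
  then show ?case
    unfolding tsubst_subst_ty using all_e by (auto intro!: typing.all_e proper_tsubst)
qed

lemma typing_lift_ty:
  "typing b \<Gamma> t A \<Longrightarrow> typing b (map (\<lambda>B. lift_ty B 0) \<Gamma>) t (lift_ty A 0)"
  using typing_tsubst[of b \<Gamma> t A "\<lambda>i. TVar (Suc i)"] by (simp add: lift_ty_0)

lemma typing_rename:
  assumes "typing b \<Gamma> t A" "\<And>i. i < length \<Gamma> \<Longrightarrow> \<xi> i < length \<Gamma>' \<and> \<Gamma>' ! \<xi> i = \<Gamma> ! i"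
  shows "typing b \<Gamma>' (psubst (\<lambda>i. Var (\<xi> i)) t) A"
  using assms
proof (induction arbitrary: \<xi> \<Gamma>' rule: typing.induct)
  case (ax i \<Gamma> b)
  then show ?case using typing.ax[of "\<xi> i" \<Gamma>' b] by simp
next
  case (arr_i B b \<Gamma> t C)
  have *: "up (\<lambda>i. Var (\<xi> i)) = (\<lambda>i. Var (case_nat 0 (\<lambda>j. Suc (\<xi> j)) i))"
    by (auto split: nat.split)
  have "typing b (B # \<Gamma>') (psubst (\<lambda>i. Var (case_nat 0 (\<lambda>j. Suc (\<xi> j)) i)) t) C"
    by (rule arr_i.IH) (use arr_i.prems in \<open>auto split: nat.split\<close>)
  then show ?case using arr_i.hyps * by (auto intro: typing.arr_i)
next
  case (arr_e b \<Gamma> u B C v)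
  have "typing b \<Gamma>' (psubst (\<lambda>i. Var (\<xi> i)) u) (Arrow B C)" "typing b \<Gamma>' (psubst (\<lambda>i. Var (\<xi> i)) v) B"
    using arr_e.IH arr_e.prems by blast+
  then show ?case by (auto intro: typing.arr_e)
next
  case (all_i A b \<Gamma> t)
  have "typing b (map (\<lambda>B. lift_ty B 0) \<Gamma>') (psubst (\<lambda>i. Var (\<xi> i)) t) A"
    by (rule all_i.IH) (use all_i.prems in auto)
  then show ?case using all_i.hyps by (auto intro: typing.all_i)
next
  case (all_e b C \<Gamma> t A)
  then show ?case by (blast intro: typing.all_e)
qed

lemma typing_psubst:
  assumes "typing b \<Gamma> t A" "\<And>i. i < length \<Gamma> \<Longrightarrow> typing b \<Gamma>' (\<sigma> i) (\<Gamma> ! i)"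
  shows "typing b \<Gamma>' (psubst \<sigma> t) A"
  using assms
proof (induction arbitrary: \<sigma> \<Gamma>' rule: typing.induct)
  case (ax i \<Gamma> b)
  then show ?case by simp
next
  case (arr_i B b \<Gamma> t C)
  have "typing b (B # \<Gamma>') (psubst (up \<sigma>) t) C"
  proof (rule arr_i.IH)
    fix i assume i: "i < length (B # \<Gamma>)"
    show "typing b (B # \<Gamma>') (up \<sigma> i) ((B # \<Gamma>) ! i)"
    proof (cases i)
      case 0
      then show ?thesis using typing.ax[of 0 "B # \<Gamma>'" b] by simp
    next
      case (Suc j)
      then have "typing b \<Gamma>' (\<sigma> j) (\<Gamma> ! j)" using i arr_i.prems by simp
      then show ?thesis using Suc by (auto simp: lift_0 intro: typing_rename)
    qed
  qed
  then show ?case using arr_i.hyps by (auto intro: typing.arr_i)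
next
  case (arr_e b \<Gamma> u B C v)
  have "typing b \<Gamma>' (psubst \<sigma> u) (Arrow B C)" "typing b \<Gamma>' (psubst \<sigma> v) B"
    using arr_e.IH arr_e.prems by blast+
  then show ?case by (auto intro: typing.arr_e)
next
  case (all_i A b \<Gamma> t)
  have "typing b (map (\<lambda>B. lift_ty B 0) \<Gamma>') (psubst \<sigma> t) A"
    by (rule all_i.IH) (use all_i.prems in \<open>auto intro: typing_lift_ty\<close>)
  then show ?case using all_i.hyps by (auto intro: typing.all_i)
next
  case (all_e b C \<Gamma> t A)
  then show ?case by (blast intro: typing.all_e)
qed

text \<open>Recursion on the type strips the leading quantifiers; since the result is stable under type
  substitution, this yields inversion for abstractions without tracking \<open>\<forall>\<close>-introduction and elimination.\<close>

primrec abs_inv :: "dB \<Rightarrow> ty list \<Rightarrow> ty \<Rightarrow> bool" where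
  "abs_inv t \<Gamma> (TVar i) = False"
| "abs_inv t \<Gamma> (TCon c) = False"
| "abs_inv t \<Gamma> (Arrow B C) = typF (B # \<Gamma>) t C"
| "abs_inv t \<Gamma> (All A) = abs_inv t (map (\<lambda>B. lift_ty B 0) \<Gamma>) A"

lemma abs_inv_tsubst:
  assumes "abs_inv t \<Gamma> A" "\<And>i. proper (\<rho> i)"
  shows "abs_inv t (map (tsubst \<rho>) \<Gamma>) (tsubst \<rho> A)"
  using assms
proof (induction A arbitrary: \<Gamma> \<rho>)
  case (Arrow B C)
  then show ?case using typing_tsubst[of True "B # \<Gamma>" t C \<rho>] by simp
next
  case (All A)
  have "proper (up_ty \<rho> i)" for i
    using All.prems(2) by (auto simp: lift_ty_0 intro: proper_tsubst split: nat.split)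
  then have "abs_inv t (map (tsubst (up_ty \<rho>)) (map (\<lambda>B. lift_ty B 0) \<Gamma>)) (tsubst (up_ty \<rho>) A)"
    using All.prems(1) by (intro All.IH) simp_all
  then show ?case unfolding map_tsubst_lift by simp
qed simp_all

lemma typing_Abs_inv:
  assumes "typing b \<Gamma> u A" "u = Abs t" "b"
  shows "abs_inv t \<Gamma> A"
  using assms
proof (induction rule: typing.induct)
  case (all_e b C \<Gamma> u A)
  then have "abs_inv t (map (\<lambda>B. lift_ty B 0) \<Gamma>) A" by simp
  \<comment> \<open>Instantiating the stripped quantifier by \<open>C\<close> cancels the lift of
    the context.\<close>
  then have "abs_inv t (map (tsubst (case_nat C TVar)) (map (\<lambda>B. lift_ty B 0) \<Gamma>))
      (tsubst (case_nat C TVar) A)"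
    by (rule abs_inv_tsubst) (use all_e.hyps in \<open>simp split: nat.split\<close>)
  then show ?case unfolding map_tsubst_scons_lift subst_ty_0 .
qed auto

text \<open>For a redex, \<open>abs_inv\<close> at an arrow type is exactly the typing of the body
  in the extended context, to which \<open>typing_psubst\<close> applies.\<close>

lemma beta_typing:
  assumes "typing b \<Gamma> t A" "b" "beta t t'"
  shows "typF \<Gamma> t' A"
  using assms
proof (induction arbitrary: t' rule: typing.induct)
  case (ax i \<Gamma> b)
  then show ?case by (auto elim: beta.cases)
next
  case (arr_i B b \<Gamma> t C)
  from arr_i.prems(2) show ?case
    by (cases rule: beta.cases) (use arr_i in \<open>auto intro: typing.arr_i\<close>)
next
  case (arr_e b \<Gamma> u B C v)
  from arr_e.prems(2) show ?case
  proof (cases rule: beta.cases)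
    case (beta_redex s)
    then have s: "typF (B # \<Gamma>) s C"
      using typing_Abs_inv[OF arr_e.hyps(1)] arr_e.prems(1) by simp
    have "typF \<Gamma> (psubst (case_nat v Var) s) C"
    proof (rule typing_psubst[OF s])
      fix i assume "i < length (B # \<Gamma>)"
      then show "typF \<Gamma> (case_nat v Var i) ((B # \<Gamma>) ! i)"
        using arr_e.hyps(2) arr_e.prems(1) by (cases i) (auto intro: typing.ax)
    qed
    then show ?thesis using beta_redex by (simp add: subst_0)
  qed (use arr_e in \<open>auto intro: typing.arr_e\<close>)
next
  case (all_i A b \<Gamma> t)
  then show ?case by (auto intro: typing.all_i)
next
  case (all_e b C \<Gamma> t A)
  then show ?case by (auto intro: typing.all_e)
qed

lemma beta_star_typing: "beta\<^sup>*\<^sup>* t t' \<Longrightarrow> typF \<Gamma> t A \<Longrightarrow> typF \<Gamma> t' A"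
  by (induction rule: rtranclp_induct) (auto intro: beta_typing)

subsection \<open>Confluence\<close>

inductive par :: "dB \<Rightarrow> dB \<Rightarrow> bool" where
  par_var: "par (Var i) (Var i)"
| par_app: "par s s' \<Longrightarrow> par t t' \<Longrightarrow> par (App s t) (App s' t')"
| par_abs: "par s s' \<Longrightarrow> par (Abs s) (Abs s')"
| par_beta: "par s s' \<Longrightarrow> par t t' \<Longrightarrow> par (App (Abs s) t) (subst s' t' 0)"

inductive_cases par_AbsE: "par (Abs s) t"

lemma par_refl [simp]: "par t t"
  by (induction t) (auto intro: par.intros)

lemma par_rename: "par s s' \<Longrightarrow> par (psubst (\<lambda>i. Var (\<xi> i)) s) (psubst (\<lambda>i. Var (\<xi> i)) s')"
proof (induction arbitrary: \<xi> rule: par.induct)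
  case (par_abs s s')
  have "up (\<lambda>i. Var (\<xi> i)) = (\<lambda>i. Var (case_nat 0 (\<lambda>j. Suc (\<xi> j)) i))"
    by (auto split: nat.split)
  then show ?case using par_abs by (auto intro: par.intros)
next
  case (par_beta s s' t t')
  have "up (\<lambda>i. Var (\<xi> i)) = (\<lambda>i. Var (case_nat 0 (\<lambda>j. Suc (\<xi> j)) i))"
    by (auto split: nat.split)
  then show ?case using par_beta by (auto simp: psubst_subst intro: par.intros)
qed (auto intro: par.intros)

lemma par_psubst:
  "par s s' \<Longrightarrow> (\<And>i. par (\<sigma> i) (\<sigma>' i)) \<Longrightarrow> par (psubst \<sigma> s) (psubst \<sigma>' s')"
proof (induction arbitrary: \<sigma> \<sigma>' rule: par.induct)
  case (par_abs s s')
  have "par (up \<sigma> i) (up \<sigma>' i)" for i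
    using par_abs.prems by (auto simp: lift_0 intro: par_rename split: nat.split)
  then show ?case using par_abs by (auto intro: par.intros)
next
  case (par_beta s s' t t')
  have "par (up \<sigma> i) (up \<sigma>' i)" for i
    using par_beta.prems by (auto simp: lift_0 intro: par_rename split: nat.split)
  then show ?case using par_beta by (auto simp: psubst_subst intro: par.intros)
qed (auto intro: par.intros)

lemma par_subst: "par s s' \<Longrightarrow> par t t' \<Longrightarrow> par (subst s t 0) (subst s' t' 0)"
  unfolding subst_0 by (rule par_psubst) (auto split: nat.split)

text \<open>A joint reduct is built by contracting on the side that has not yet done so. In the
  mixed cases this is possible since a parallel reduct of an abstraction is again an
  abstraction.\<close>

lemma par_diamond: "par s t \<Longrightarrow> par s u \<Longrightarrow> \<exists>v. par t v \<and> par u v"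
proof (induction arbitrary: u rule: par.induct)
  case (par_var i)
  then show ?case by auto
next
  case (par_app s s' t t')
  from par_app.prems show ?case
  proof (cases rule: par.cases)
    case (par_beta s1 s1' t1')
    obtain v where v: "par s' v" "par (Abs s1') v"
      using par_app.IH(1)[of "Abs s1'"] par_beta par.par_abs by blast
    obtain w where w: "par t' w" "par t1' w"
      using par_app.IH(2) par_beta by blast
    obtain s2 where s2: "s' = Abs s2" "par s1 s2"
      using par_app.hyps(1) par_beta by (auto elim: par_AbsE)
    with v obtain v' where "v = Abs v'" "par s2 v'" "par s1' v'"
      by (auto elim!: par_AbsE)
    then show ?thesis using s2 w par_beta by (auto intro: par.par_beta par_subst)
  next
    case (par_app s1 t1)
    then show ?thesis using par_app.IH by (meson par.par_app)
  qed
next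
  case (par_abs s s')
  then show ?case by (fastforce elim!: par_AbsE intro: par.par_abs)
next
  case (par_beta s s' t t')
  from par_beta.prems show ?case
  proof (cases rule: par.cases)
    case (par_app s1 t1)
    then obtain s2 where "s1 = Abs s2" "par s s2"
      by (auto elim: par_AbsE)
    then show ?thesis using par_app par_beta.IH by (meson par.par_beta par_subst)
  next
    case (par_beta s1' t1')
    then show ?thesis using par_beta.IH by (meson par_subst)
  qed
qed

lemma beta_star_App:
  "beta\<^sup>*\<^sup>* s s' \<Longrightarrow> beta\<^sup>*\<^sup>* t t' \<Longrightarrow> beta\<^sup>*\<^sup>* (App s t) (App s' t')"
proof -
  assume "beta\<^sup>*\<^sup>* s s'" "beta\<^sup>*\<^sup>* t t'"
  from this(1) have "beta\<^sup>*\<^sup>* (App s t) (App s' t)"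
    by (induction rule: rtranclp_induct) (auto intro: rtranclp.rtrancl_into_rtrancl beta.intros)
  also from \<open>beta\<^sup>*\<^sup>* t t'\<close> have "beta\<^sup>*\<^sup>* (App s' t) (App s' t')"
    by (induction rule: rtranclp_induct) (auto intro: rtranclp.rtrancl_into_rtrancl beta.intros)
  finally show ?thesis .
qed

lemma beta_star_Abs: "beta\<^sup>*\<^sup>* s s' \<Longrightarrow> beta\<^sup>*\<^sup>* (Abs s) (Abs s')"
  by (induction rule: rtranclp_induct) (auto intro: rtranclp.rtrancl_into_rtrancl beta.intros)

lemma beta_imp_par: "beta s t \<Longrightarrow> par s t"
  by (induction rule: beta.induct) (auto intro: par.intros)

lemma par_imp_beta_star: "par s t \<Longrightarrow> beta\<^sup>*\<^sup>* s t"
proof (induction rule: par.induct)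
  case (par_beta s s' t t')
  then have "beta\<^sup>*\<^sup>* (App (Abs s) t) (App (Abs s') t')"
    by (intro beta_star_App beta_star_Abs)
  then show ?case by (blast intro: rtranclp.rtrancl_into_rtrancl beta.intros)
qed (auto intro: beta_star_App beta_star_Abs)

lemma confluentp_beta: "confluentp beta"
proof -
  have "strong_confluentp par"
    by (rule strong_confluentpI) (use par_diamond in blast)
  then have "confluentp par"
    by (rule strong_confluentp_imp_confluentp)
  moreover have "par\<^sup>*\<^sup>* = beta\<^sup>*\<^sup>*"
  proof (rule antisym)
    show "par\<^sup>*\<^sup>* \<le> beta\<^sup>*\<^sup>*"
      using rtranclp_mono[of par "beta\<^sup>*\<^sup>*"] par_imp_beta_star by auto
    show "beta\<^sup>*\<^sup>* \<le> par\<^sup>*\<^sup>*"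
      using beta_imp_par by (intro rtranclp_mono) auto
  qed
  ultimately show ?thesis by (simp add: confluentp_conv_strong_confluentp_rtranclp)
qed

lemma normal_no_beta: "beta t t' \<Longrightarrow> \<not> normal t"
  by (induction rule: beta.induct) (auto simp: normal_def)

text \<open>By Church-Rosser both terms have a common reduct; confluence joins it with
  \<open>n\<close>, which cannot move. This turns equivalence with \<open>t\<close> into reduction
  to the normal form of \<open>t\<close>, where standardization can start.\<close>

lemma beta_eq_normal:
  assumes "beta_eq s t" "beta\<^sup>*\<^sup>* t n" "normal n"
  shows "beta\<^sup>*\<^sup>* s n"
proof -
  have "equivclp beta = beta\<^sup>*\<^sup>* OO beta\<inverse>\<inverse>\<^sup>*\<^sup>*"
    using confluentp_beta by (intro semiconfluentp_equivclp confluentp_imp_semiconfluentp)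
  with assms(1) obtain u where "beta\<^sup>*\<^sup>* s u" "beta\<^sup>*\<^sup>* t u"
    by (auto simp: beta_eq_def rtranclp_conversep)
  moreover obtain v where "beta\<^sup>*\<^sup>* u v" "beta\<^sup>*\<^sup>* n v"
    using confluentpD[OF confluentp_beta \<open>beta\<^sup>*\<^sup>* t u\<close> assms(2)] by blast
  moreover have "n = v"
    using \<open>beta\<^sup>*\<^sup>* n v\<close> assms(3) normal_no_beta by (auto elim: converse_rtranclpE)
  ultimately show ?thesis by auto
qed

subsection \<open>Weak head reduction and standardization\<close>

inductive_cases whr_AbsE: "whr (Abs s) u"
inductive_cases whr_AppE: "whr (App s t) u"

lemma whr_Abs_App_eq: "whr (App (Abs u) v) t \<longleftrightarrow> t = subst u v 0"
  by (auto elim!: whr_AppE whr_AbsE intro: whr.intros)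

lemma whr_deterministic: "whr s t \<Longrightarrow> whr s u \<Longrightarrow> t = u"
proof (induction arbitrary: u rule: whr.induct)
  case (whr_app s s' t)
  from whr_app.prems show ?case
    by (rule whr_AppE) (use whr_app.hyps whr_app.IH in \<open>blast elim: whr_AbsE\<close>)+
qed (simp add: whr_Abs_App_eq)

lemma whr_psubst: "whr s t \<Longrightarrow> whr (psubst \<sigma> s) (psubst \<sigma> t)"
  by (induction rule: whr.induct) (auto simp: psubst_subst intro: whr.intros)

lemma whr_star_psubst: "whr\<^sup>*\<^sup>* s t \<Longrightarrow> whr\<^sup>*\<^sup>* (psubst \<sigma> s) (psubst \<sigma> t)"
  by (induction rule: rtranclp_induct) (auto intro: whr_psubst rtranclp.rtrancl_into_rtrancl)

lemma whr_foldl: "whr s t \<Longrightarrow> whr (foldl App s cs) (foldl App t cs)"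
  by (induction cs arbitrary: s t) (auto intro: whr.intros)

lemma whr_star_foldl: "whr\<^sup>*\<^sup>* s t \<Longrightarrow> whr\<^sup>*\<^sup>* (foldl App s cs) (foldl App t cs)"
  by (induction rule: rtranclp_induct) (auto intro: whr_foldl rtranclp.rtrancl_into_rtrancl)

lemma whr_star_App: "whr\<^sup>*\<^sup>* s t \<Longrightarrow> whr\<^sup>*\<^sup>* (App s u) (App t u)"
  using whr_star_foldl[of s t "[u]"] by simp

lemma whr_imp_beta: "whr s t \<Longrightarrow> beta s t"
  by (induction rule: whr.induct) (auto intro: beta.intros)

text \<open>Standard reduction, in the style of Loader and Kashima: absorbing a \<open>\<beta>\<close>-step on the right
  is the standardization theorem.\<close>

inductive st :: "dB \<Rightarrow> dB \<Rightarrow> bool" where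
  st_Var: "whr\<^sup>*\<^sup>* s (Var i) \<Longrightarrow> st s (Var i)"
| st_App: "whr\<^sup>*\<^sup>* s (App u v) \<Longrightarrow> st u u' \<Longrightarrow> st v v' \<Longrightarrow> st s (App u' v')"
| st_Abs: "whr\<^sup>*\<^sup>* s (Abs u) \<Longrightarrow> st u u' \<Longrightarrow> st s (Abs u')"

inductive_cases st_VarE: "st s (Var i)"
inductive_cases st_AppE: "st s (App u v)"
inductive_cases st_AbsE: "st s (Abs u)"

lemma st_refl [simp]: "st t t"
  by (induction t) (auto intro: st.intros)

lemma whr_st: "whr\<^sup>*\<^sup>* s t \<Longrightarrow> st t u \<Longrightarrow> st s u"
  by (erule st.cases) (auto intro: st.intros rtranclp_trans)

lemma st_rename: "st s t \<Longrightarrow> st (psubst (\<lambda>i. Var (\<xi> i)) s) (psubst (\<lambda>i. Var (\<xi> i)) t)"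
proof (induction arbitrary: \<xi> rule: st.induct)
  case (st_Var s i)
  then show ?case using whr_star_psubst[OF st_Var.hyps] by (auto intro: st.intros)
next
  case (st_App s u v u' v')
  then show ?case using whr_star_psubst[OF st_App.hyps(1)] by (auto intro: st.intros)
next
  case (st_Abs s u u')
  have "up (\<lambda>i. Var (\<xi> i)) = (\<lambda>i. Var (case_nat 0 (\<lambda>j. Suc (\<xi> j)) i))"
    by (auto split: nat.split)
  then show ?case
    using st_Abs whr_star_psubst[OF st_Abs.hyps(1), of "\<lambda>i. Var (\<xi> i)"] by (auto intro: st.intros)
qed

lemma st_psubst:
  "st s t \<Longrightarrow> (\<And>i. st (\<sigma> i) (\<sigma>' i)) \<Longrightarrow> st (psubst \<sigma> s) (psubst \<sigma>' t)"
proof (induction arbitrary: \<sigma> \<sigma>' rule: st.induct)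
  case (st_Var s i)
  then show ?case using whr_star_psubst[OF st_Var.hyps, of \<sigma>] whr_st by auto
next
  case (st_App s u v u' v')
  then show ?case using whr_star_psubst[OF st_App.hyps(1), of \<sigma>] by (auto intro: st.intros)
next
  case (st_Abs s u u')
  have "st (up \<sigma> i) (up \<sigma>' i)" for i
    using st_Abs.prems by (auto simp: lift_0 intro: st_rename split: nat.split)
  then show ?case
    using st_Abs whr_star_psubst[OF st_Abs.hyps(1), of \<sigma>] by (auto intro: st.intros)
qed

lemma st_beta: "beta t u \<Longrightarrow> st s t \<Longrightarrow> st s u"
proof (induction arbitrary: s rule: beta.induct)
  case (beta_redex t v)
  from beta_redex.prems obtain p q where 1: "whr\<^sup>*\<^sup>* s (App p q)" "st p (Abs t)" "st q v"
    by (auto elim: st_AppE)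
  from 1(2) obtain r where 2: "whr\<^sup>*\<^sup>* p (Abs r)" "st r t"
    by (auto elim: st_AbsE)
  \<comment> \<open>The two head reductions expose the redex, which is contracted at once; what
    remains is standard by \<open>st_psubst\<close>.\<close>
  have "whr\<^sup>*\<^sup>* s (subst r q 0)"
    using 1(1) whr_star_App[OF 2(1), of q] by (meson rtranclp.simps rtranclp_trans whr_redex)
  moreover have "st (subst r q 0) (subst t v 0)"
    unfolding subst_0 by (rule st_psubst[OF 2(2)]) (use 1(3) in \<open>auto split: nat.split\<close>)
  ultimately show ?case by (rule whr_st)
next
  case (beta_abs t t')
  then show ?case by (auto elim!: st_AbsE intro: st.intros)
next
  case (beta_appL t t' u)
  then show ?case by (auto elim!: st_AppE intro: st.intros)
next
  case (beta_appR t t' u)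
  then show ?case by (auto elim!: st_AppE intro: st.intros)
qed

lemma beta_star_st: "beta\<^sup>*\<^sup>* s t \<Longrightarrow> st s t"
  by (induction rule: rtranclp_induct) (auto intro: st_beta)

subsection \<open>Weak normalization\<close>

text \<open>Leftmost normalization is closed under weak head expansion by definition, so that reducibility
  candidates inside it require no expansion lemma.\<close>

inductive wn :: "dB \<Rightarrow> bool" and ne :: "dB \<Rightarrow> bool" where
  wn_ne: "ne t \<Longrightarrow> wn t"
| wn_Abs: "wn t \<Longrightarrow> wn (Abs t)"
| wn_whr: "whr t t' \<Longrightarrow> wn t' \<Longrightarrow> wn t"
| ne_Var: "ne (Var i)"
| ne_App: "ne s \<Longrightarrow> wn t \<Longrightarrow> ne (App s t)"

inductive_cases ne_AbsE: "ne (Abs t)"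
inductive_cases ne_AppE: "ne (App s t)"

text \<open>A renaming sends variables to variables, so it creates no redex.\<close>

lemma whr_rename_inv:
  "whr (psubst (\<lambda>i. Var (\<xi> i)) r) u \<Longrightarrow> \<exists>r'. whr r r' \<and> u = psubst (\<lambda>i. Var (\<xi> i)) r'"
proof (induction r arbitrary: u)
  case (Var i)
  then show ?case by (auto elim: whr.cases)
next
  case (Abs r)
  then show ?case by (auto elim: whr_AbsE)
next
  case (App r s)
  from App.prems have "whr (App (psubst (\<lambda>i. Var (\<xi> i)) r) (psubst (\<lambda>i. Var (\<xi> i)) s)) u"
    by simp
  then show ?case
  proof (rule whr_AppE)
    fix v assume v: "psubst (\<lambda>i. Var (\<xi> i)) r = Abs v" "u = subst v (psubst (\<lambda>i. Var (\<xi> i)) s) 0"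
    then obtain r' where "r = Abs r'" by (cases r) auto
    with v show ?thesis by (auto simp: psubst_subst intro!: exI[of _ "subst r' s 0"] whr.intros)
  next
    fix v assume "u = App v (psubst (\<lambda>i. Var (\<xi> i)) s)" "whr (psubst (\<lambda>i. Var (\<xi> i)) r) v"
    with App.IH(1) obtain r' where "whr r r'" "u = psubst (\<lambda>i. Var (\<xi> i)) (App r' s)"
      by fastforce
    then show ?thesis by (blast intro: whr.intros)
  qed
qed

lemma wn_rename_inv:
  "wn u \<Longrightarrow> u = psubst (\<lambda>i. Var (\<xi> i)) r \<Longrightarrow> wn r"
  "ne u \<Longrightarrow> u = psubst (\<lambda>i. Var (\<xi> i)) r \<Longrightarrow> ne r"
proof (induction arbitrary: \<xi> r and \<xi> r rule: wn_ne.inducts)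
  case (wn_ne t)
  then show ?case by (blast intro: wn_ne.intros)
next
  case (wn_Abs t)
  then obtain r' where r: "r = Abs r'" by (cases r) auto
  have "up (\<lambda>i. Var (\<xi> i)) = (\<lambda>i. Var (case_nat 0 (\<lambda>j. Suc (\<xi> j)) i))"
    by (auto split: nat.split)
  then have "wn r'" using wn_Abs r by simp
  then show ?case using r by (auto intro: wn_ne.intros)
next
  case (wn_whr t t')
  then show ?case using whr_rename_inv by (metis wn_ne.wn_whr)
next
  case (ne_Var i)
  then show ?case by (cases r) (auto intro: wn_ne.intros)
next
  case (ne_App s t)
  then obtain r1 r2 where "r = App r1 r2" by (cases r) auto
  then show ?case using ne_App by (auto intro: wn_ne.intros)
qed

text \<open>Shows that terms reducible at an arrow type normalize. If \<open>t\<close> is an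
  abstraction, the contractum is a renaming of its body, so \<open>wn_rename_inv\<close> applies;
  otherwise the derivation passes to \<open>t\<close> directly. The goal \<open>True\<close> for
  \<open>ne\<close> completes the mutual induction.\<close>

lemma wn_App_Var: "wn u \<Longrightarrow> u = App t (Var n) \<Longrightarrow> wn t"
  and "ne u \<Longrightarrow> True"
proof (induction arbitrary: t rule: wn_ne.inducts)
  case (wn_ne u)
  then show ?case by (auto elim: ne_AppE intro: wn_ne.intros)
next
  case (wn_whr u u')
  from wn_whr.hyps wn_whr.prems have "whr (App t (Var n)) u'" by simp
  then show ?case
  proof (rule whr_AppE)
    fix v assume v: "t = Abs v" "u' = subst v (Var n) 0"
    have "case_nat (Var n) Var = (\<lambda>i. Var (case_nat n id i))"
      by (auto split: nat.split)
    then have "wn v"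
      using wn_rename_inv(1)[OF wn_whr.hyps(2)] v by (simp add: subst_0)
    then show ?thesis using v by (auto intro: wn_ne.intros)
  next
    fix v assume "u' = App v (Var n)" "whr t v"
    then show ?thesis using wn_whr.IH by (blast intro: wn_ne.intros)
  qed
qed simp_all

section \<open>Reducibility candidates and adequacy\<close>

definition cand :: "dB set \<Rightarrow> bool" where
  "cand X \<longleftrightarrow> (\<forall>t\<in>X. wn t) \<and> (\<forall>t. ne t \<longrightarrow> t \<in> X) \<and> (\<forall>t t'. whr t t' \<longrightarrow> t' \<in> X \<longrightarrow> t \<in> X)"

primrec interp :: "(nat \<Rightarrow> dB set) \<Rightarrow> ty \<Rightarrow> dB set" where
  "interp \<xi> (TVar i) = \<xi> i"
| "interp \<xi> (TCon c) = {t. wn t}"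
| "interp \<xi> (Arrow A B) = {t. \<forall>a\<in>interp \<xi> A. App t a \<in> interp \<xi> B}"
| "interp \<xi> (All A) = {t. \<forall>X. cand X \<longrightarrow> t \<in> interp (case_nat X \<xi>) A}"

lemma cand_wn: "cand {t. wn t}"
  by (auto simp: cand_def intro: wn_ne.intros)

lemma cand_case_nat: "cand X \<Longrightarrow> (\<And>i. cand (\<xi> i)) \<Longrightarrow> cand (case_nat X \<xi> i)"
  by (cases i) auto

lemma cand_interp: "(\<And>i. cand (\<xi> i)) \<Longrightarrow> cand (interp \<xi> A)"
proof (induction A arbitrary: \<xi>)
  case (Arrow A B)
  have A: "cand (interp \<xi> A)" and B: "cand (interp \<xi> B)"
    using Arrow by blast+
  show ?case
    unfolding cand_def
  proof (intro conjI ballI allI impI)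
    fix t assume "t \<in> interp \<xi> (Arrow A B)"
    \<comment> \<open>A variable is neutral, hence in every candidate, and can serve as a test
      argument for \<open>t\<close>.\<close>
    moreover have "Var 0 \<in> interp \<xi> A" using A by (auto simp: cand_def intro: ne_Var)
    ultimately have "wn (App t (Var 0))" using B by (auto simp: cand_def)
    then show "wn t" using wn_App_Var by blast
  next
    fix t assume "ne t"
    then show "t \<in> interp \<xi> (Arrow A B)" using A B unfolding cand_def interp.simps mem_Collect_eq by (blast intro: ne_App)
  next
    fix t t' assume "whr t t'" "t' \<in> interp \<xi> (Arrow A B)"
    then show "t \<in> interp \<xi> (Arrow A B)" using B unfolding cand_def interp.simps mem_Collect_eq by (blast intro: whr_app)
  qed
next
  case (All A)
  have IH: "cand (interp (case_nat X \<xi>) A)" if "cand X" for X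
    by (rule All.IH) (use that All.prems in \<open>rule cand_case_nat\<close>)
  show ?case
    unfolding cand_def
  proof (intro conjI ballI allI impI)
    fix t assume "t \<in> interp \<xi> (All A)"
    \<comment> \<open>The set of all normalizing terms is itself a candidate and supplies an
      instance of the quantifier.\<close>
    with cand_wn have "t \<in> interp (case_nat {t. wn t} \<xi>) A" by simp
    then show "wn t" using IH[OF cand_wn] unfolding cand_def by blast
  next
    fix t assume *: "ne t"
    have "t \<in> interp (case_nat X \<xi>) A" if "cand X" for X
      using IH[OF that] * unfolding cand_def by blast
    then show "t \<in> interp \<xi> (All A)" by simp
  next
    fix t t' assume *: "whr t t'" "t' \<in> interp \<xi> (All A)"
    have "t \<in> interp (case_nat X \<xi>) A" if "cand X" for X
      using IH[OF that] * that unfolding cand_def interp.simps mem_Collect_eq by blast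
    then show "t \<in> interp \<xi> (All A)" by simp
  qed
qed (simp_all add: cand_wn)

lemma interp_rename: "interp \<xi> (tsubst (\<lambda>i. TVar (r i)) A) = interp (\<lambda>i. \<xi> (r i)) A"
proof (induction A arbitrary: \<xi> r)
  case (All A)
  have "up_ty (\<lambda>i. TVar (r i)) = (\<lambda>i. TVar (case_nat 0 (\<lambda>j. Suc (r j)) i))"
    by (auto split: nat.split)
  moreover have "(\<lambda>i. case_nat X \<xi> (case_nat 0 (\<lambda>j. Suc (r j)) i)) = case_nat X (\<lambda>i. \<xi> (r i))" for X
    by (rule ext) (simp split: nat.split)
  ultimately show ?case by (simp add: All)
qed auto

lemma interp_tsubst: "interp \<xi> (tsubst \<rho> A) = interp (\<lambda>i. interp \<xi> (\<rho> i)) A"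
proof (induction A arbitrary: \<xi> \<rho>)
  case (All A)
  have "(\<lambda>i. interp (case_nat X \<xi>) (up_ty \<rho> i)) = case_nat X (\<lambda>i. interp \<xi> (\<rho> i))" for X
    by (rule ext) (auto simp: lift_ty_0 interp_rename split: nat.split)
  then show ?case by (simp add: All)
qed auto

lemma interp_subst_ty: "interp \<xi> (subst_ty A C 0) = interp (case_nat (interp \<xi> C) \<xi>) A"
proof -
  have "(\<lambda>i. interp \<xi> (case_nat C TVar i)) = case_nat (interp \<xi> C) \<xi>"
    by (rule ext) (auto split: nat.split)
  then show ?thesis by (simp add: subst_ty_0 interp_tsubst)
qed

text \<open>In the abstraction case one head step leads to the body under the extended environment,
  and candidates are closed under head expansion.\<close>

lemma adequacy:
  assumes "typing b \<Gamma> t A" "\<And>i. cand (\<xi> i)" "\<And>i. i < length \<Gamma> \<Longrightarrow> \<sigma> i \<in> interp \<xi> (\<Gamma> ! i)"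
  shows "psubst \<sigma> t \<in> interp \<xi> A"
  using assms
proof (induction arbitrary: \<xi> \<sigma> rule: typing.induct)
  case (ax i \<Gamma> b)
  then show ?case by simp
next
  case (arr_i B b \<Gamma> t C)
  have C: "cand (interp \<xi> C)" using arr_i.prems(1) by (rule cand_interp)
  have "App (psubst \<sigma> (Abs t)) a \<in> interp \<xi> C" if "a \<in> interp \<xi> B" for a
  proof -
    have "psubst (case_nat a \<sigma>) t \<in> interp \<xi> C"
    proof (rule arr_i.IH[OF arr_i.prems(1)])
      fix i assume "i < length (B # \<Gamma>)"
      then show "case_nat a \<sigma> i \<in> interp \<xi> ((B # \<Gamma>) ! i)"
        using that arr_i.prems(2) by (cases i) auto
    qed
    moreover have "whr (App (psubst \<sigma> (Abs t)) a) (psubst (case_nat a \<sigma>) t)"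
      using whr_redex[of "psubst (up \<sigma>) t" a] by (simp add: subst_psubst_up)
    ultimately show ?thesis using C unfolding cand_def by blast
  qed
  then show ?case by simp
next
  case (arr_e b \<Gamma> u B C v)
  have "psubst \<sigma> u \<in> interp \<xi> (Arrow B C)" "psubst \<sigma> v \<in> interp \<xi> B"
    using arr_e.IH arr_e.prems by blast+
  then show ?case by simp
next
  case (all_i A b \<Gamma> t)
  have "psubst \<sigma> t \<in> interp (case_nat X \<xi>) A" if "cand X" for X
  proof (rule all_i.IH)
    show "cand (case_nat X \<xi> i)" for i
      using that all_i.prems(1) by (rule cand_case_nat)
  next
    fix i assume "i < length (map (\<lambda>B. lift_ty B 0) \<Gamma>)"
    then show "\<sigma> i \<in> interp (case_nat X \<xi>) (map (\<lambda>B. lift_ty B 0) \<Gamma> ! i)"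
      using all_i.prems(2) by (simp add: lift_ty_0 interp_rename)
  qed
  then show ?case by simp
next
  case (all_e b C \<Gamma> t A)
  then have "psubst \<sigma> t \<in> interp \<xi> (All A)" by blast
  then show ?case using cand_interp[OF all_e.prems(1), where A = C] by (simp add: interp_subst_ty)
qed

lemma typing_wn: "typing b \<Gamma> t A \<Longrightarrow> wn t"
proof -
  assume t: "typing b \<Gamma> t A"
  have c: "cand ((\<lambda>_. {t. wn t}) i)" for i :: nat
    by (rule cand_wn)
  have "psubst Var t \<in> interp (\<lambda>_. {t. wn t}) A"
    by (rule adequacy[OF t c]) (use cand_interp[OF c] ne_Var in \<open>auto simp: cand_def\<close>)
  with cand_interp[OF c, where A = A] show "wn t" by (simp add: cand_def)
qed

text \<open>The claim for neutral terms also excludes abstractions as normal forms, so that applying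
  one to a normal argument creates no redex.\<close>

lemma wn_normal_form: "wn t \<Longrightarrow> \<exists>n. beta\<^sup>*\<^sup>* t n \<and> normal n"
  and "ne t \<Longrightarrow> \<exists>n. beta\<^sup>*\<^sup>* t n \<and> normal n \<and> (\<forall>u. n \<noteq> Abs u)"
proof (induction rule: wn_ne.inducts)
  case (wn_Abs t)
  then obtain n where "beta\<^sup>*\<^sup>* t n" "normal n" by blast
  then show ?case by (intro exI[of _ "Abs n"]) (auto simp: normal_def intro: beta_star_Abs)
next
  case (wn_whr t t')
  then show ?case by (meson whr_imp_beta converse_rtranclp_into_rtranclp)
next
  case (ne_Var i)
  show ?case by (intro exI[of _ "Var i"]) (auto simp: normal_def)
next
  case (ne_App s t)
  then obtain m n where "beta\<^sup>*\<^sup>* s m" "normal m" "\<forall>u. m \<noteq> Abs u" "beta\<^sup>*\<^sup>* t n" "normal n"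
    by blast
  then show ?case by (intro exI[of _ "App m n"]) (auto simp: normal_def intro: beta_star_App)
qed auto

section \<open>Bounds on the number of weak head steps\<close>

definition whr_bound :: "nat \<Rightarrow> dB \<Rightarrow> bool" where
  "whr_bound N t \<longleftrightarrow> (\<forall>n u. (whr ^^ n) t u \<longrightarrow> n \<le> N)"

lemma whr_bound_star: "whr_bound N t \<Longrightarrow> whr\<^sup>*\<^sup>* t u \<Longrightarrow> whr_bound N u"
  unfolding whr_bound_def rtranclp_power by (metis add_leE relcomppI relpowp_add)

text \<open>A nonempty run uses up part of the bound, so the bound can serve as the measure of a
  well-founded induction.\<close>

lemma whr_bound_plus:
  assumes "whr_bound N t" "whr\<^sup>+\<^sup>+ t u"
  shows "\<exists>N'<N. whr_bound N' u"
proof -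
  from assms(2) obtain n where n: "n > 0" "(whr ^^ n) t u"
    by (auto simp: tranclp_power)
  have "n + m \<le> N" if "(whr ^^ m) u v" for m v
    using assms(1) n(2) that unfolding whr_bound_def by (metis relcomppI relpowp_add)
  then have "whr_bound (N - n) u" unfolding whr_bound_def by fastforce
  moreover have "n \<le> N" using assms(1) n(2) unfolding whr_bound_def by blast
  ultimately show ?thesis using n(1) by (intro exI[of _ "N - n"]) auto
qed

lemma whr_bound_nf: "(\<And>u. \<not> whr t u) \<Longrightarrow> whr_bound 0 t"
  unfolding whr_bound_def by (metis le_refl not0_implies_Suc relpowp_Suc_E2)

text \<open>By determinism, a bound for the unique successor plus one bounds the term itself;
  neutral terms and abstractions make no head step.\<close>

lemma wn_whr_bound: "wn t \<Longrightarrow> \<exists>N. whr_bound N t"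
  and ne_no_whr: "ne t \<Longrightarrow> \<not> whr t u"
proof (induction arbitrary: and u rule: wn_ne.inducts)
  case (wn_ne t)
  then show ?case using whr_bound_nf by blast
next
  case (wn_Abs t)
  then show ?case using whr_bound_nf by (metis whr_AbsE)
next
  case (wn_whr t t')
  then obtain N where N: "whr_bound N t'" by blast
  have "n \<le> Suc N" if "(whr ^^ n) t u" for n u
  proof (cases n)
    case (Suc m)
    with that obtain v where "whr t v" "(whr ^^ m) v u" by (meson relpowp_Suc_E2)
    with wn_whr.hyps(1) whr_deterministic have "(whr ^^ m) t' u" by blast
    with N Suc show ?thesis by (auto simp: whr_bound_def)
  qed simp
  then show ?case unfolding whr_bound_def by blast
next
  case (ne_Var i)
  then show ?case by (auto elim: whr.cases)
next
  case (ne_App s t)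
  then show ?case by (blast elim: whr_AppE ne_AbsE)
qed

subsection \<open>Erasing free variables\<close>

text \<open>Replaces \<open>\<bottom>\<close> (constant \<open>1\<close>) by \<open>O\<close> (constant \<open>0\<close>).\<close>

primrec rcon :: "ty \<Rightarrow> ty" where
  "rcon (TVar i) = TVar i"
| "rcon (TCon c) = TCon (if c = 1 then 0 else c)"
| "rcon (Arrow A B) = Arrow (rcon A) (rcon B)"
| "rcon (All A) = All (rcon A)"

lemma ftv_rcon [simp]: "ftv (rcon A) = ftv A"
  by (induction A) auto

lemma proper_rcon [simp]: "proper (rcon A) = proper A"
  by (induction A) auto

lemma rcon_lift: "rcon (lift_ty A k) = lift_ty (rcon A) k"
  by (induction A arbitrary: k) auto

lemma rcon_subst: "rcon (subst_ty A C k) = subst_ty (rcon A) (rcon C) k"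
  by (induction A arbitrary: C k) (auto simp: rcon_lift)

lemma rcon_id: "1 \<notin> tcons A \<Longrightarrow> rcon A = A"
  by (induction A) auto

lemma typing_rcon: "typing b \<Gamma> t A \<Longrightarrow> typing b (map rcon \<Gamma>) t (rcon A)"
proof (induction rule: typing.induct)
  case (ax i \<Gamma> b)
  then show ?case using typing.ax[of i "map rcon \<Gamma>" b] by simp
next
  case (all_i A b \<Gamma> t)
  then show ?case by (auto simp: rcon_lift comp_def intro!: typing.all_i)
next
  case (all_e b C \<Gamma> t A)
  then show ?case by (auto simp: rcon_subst intro!: typing.all_e)
qed (auto intro: typing.intros)

section \<open>Constant functions at translated types\<close>

definition const_abs :: "nat \<Rightarrow> nat \<Rightarrow> dB" where
  "const_abs r a = (Abs ^^ r) (Var (a + r))"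

lemma const_abs_0 [simp]: "const_abs 0 a = Var a"
  by (simp add: const_abs_def)

lemma const_abs_Suc [simp]: "const_abs (Suc r) a = Abs (const_abs r (Suc a))"
  by (simp add: const_abs_def)

lemma frees_const_abs [simp]: "frees (const_abs r a) = {a}"
  by (induction r arbitrary: a) auto

lemma normal_const_abs [simp]: "normal (const_abs r a)"
  by (induction r arbitrary: a) (auto simp: normal_def)

lemma psubst_const_abs: "\<sigma> a = Var c \<Longrightarrow> psubst \<sigma> (const_abs r a) = const_abs r c"
  by (induction r arbitrary: \<sigma> a c) auto

text \<open>A translated type ends on the right in \<bottom>, which \<open>rcon\<close> turns into
  O, so it suffices to discard all arguments and return \<open>a\<close>. An atom contributes one
  abstraction, an arrow one more than its target, a quantifier none. As the final \<bottom> is a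
  constant, \<rho> changes only the types of the arguments.\<close>

lemma const_abs_typing:
  assumes "proper A" "\<And>i. proper (\<rho> i)" "a < length \<Gamma>" "\<Gamma> ! a = tyO"
  shows "\<exists>r. typF \<Gamma> (const_abs r a) (rcon (tsubst \<rho> (goedel A)))"
  using assms
proof (induction A arbitrary: \<Gamma> a \<rho>)
  case (TVar i)
  have "typF \<Gamma> (const_abs (Suc 0) a) (Arrow (rcon (\<rho> i)) tyO)"
    using TVar typing.ax[of "Suc a" "rcon (\<rho> i) # \<Gamma>" True] by (auto intro!: typing.arr_i)
  then have "typF \<Gamma> (const_abs (Suc 0) a) (rcon (tsubst \<rho> (goedel (TVar i))))"
    by (simp add: neg_def tyBot_def tyO_def)
  then show ?case by blast
next
  case (TCon c)
  have "typF \<Gamma> (const_abs (Suc 0) a) (Arrow (rcon (TCon c)) tyO)"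
    using TCon typing.ax[of "Suc a" "rcon (TCon c) # \<Gamma>" True] by (auto intro!: typing.arr_i)
  then have "typF \<Gamma> (const_abs (Suc 0) a) (rcon (tsubst \<rho> (goedel (TCon c))))"
    by (simp add: neg_def tyBot_def tyO_def)
  then show ?case by blast
next
  case (Arrow A B)
  let ?A = "rcon (tsubst \<rho> (goedel A))"
  obtain r where "typF (?A # \<Gamma>) (const_abs r (Suc a)) (rcon (tsubst \<rho> (goedel B)))"
    using Arrow.IH(2)[of \<rho> "Suc a" "?A # \<Gamma>"] Arrow.prems by auto
  then have "typF \<Gamma> (const_abs (Suc r) a) (rcon (tsubst \<rho> (goedel (Arrow A B))))"
    using Arrow.prems by (auto intro!: typing.arr_i proper_tsubst proper_goedel)
  then show ?case by blast
next
  case (All A)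
  have "proper (up_ty \<rho> i)" for i
    using All.prems(2) by (auto simp: lift_ty_0 intro: proper_tsubst split: nat.split)
  then obtain r where
    "typF (map (\<lambda>B. lift_ty B 0) \<Gamma>) (const_abs r a) (rcon (tsubst (up_ty \<rho>) (goedel A)))"
    using All.IH[of "up_ty \<rho>" a "map (\<lambda>B. lift_ty B 0) \<Gamma>"] All.prems by (auto simp: tyO_def)
  then have "typF \<Gamma> (const_abs r a) (rcon (tsubst \<rho> (goedel (All A))))"
    using All.prems by (auto intro!: typing.all_i ftv_up_ty)
  then show ?case by blast
qed

text \<open>A constant function discards its arguments but keeps its own \<open>a\<close>, so an
  \<open>a\<close> put in by \<sigma> never vanishes altogether. The last conjunct feeds the
  application case: an abstraction that newly reaches head position is such a constant
  function.\<close>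

lemma const_abs_normal_form:
  assumes "normal t" "\<And>i. (\<exists>r. \<sigma> i = const_abs r a) \<or> (\<exists>j. \<sigma> i = Var j)"
  shows "\<exists>n. beta\<^sup>*\<^sup>* (psubst \<sigma> t) n \<and> normal n
    \<and> ((\<exists>i\<in>frees t. \<exists>r. \<sigma> i = const_abs r a) \<longrightarrow> a \<in> frees n)
    \<and> ((\<forall>u. t \<noteq> Abs u) \<longrightarrow> (\<exists>r. n = const_abs r a) \<or> (\<forall>u. n \<noteq> Abs u))"
  using assms
proof (induction t arbitrary: \<sigma> a)
  case (Var i)
  from Var.prems(2)[of i] have "normal (\<sigma> i)"
    by (auto simp: normal_def[of "Var _"])
  moreover have "\<forall>r. \<sigma> i = const_abs r a \<longrightarrow> a \<in> frees (\<sigma> i)" by simp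
  moreover have "(\<exists>r. \<sigma> i = const_abs r a) \<or> (\<forall>u. \<sigma> i \<noteq> Abs u)"
    using Var.prems(2)[of i] by auto
  ultimately show ?case unfolding psubst.simps frees.simps by blast
next
  case (App s t)
  then have st: "normal s" "normal t" "\<forall>u. s \<noteq> Abs u" by (auto simp: normal_def)
  obtain m where m: "beta\<^sup>*\<^sup>* (psubst \<sigma> s) m" "normal m"
      "(\<exists>i\<in>frees s. \<exists>r. \<sigma> i = const_abs r a) \<longrightarrow> a \<in> frees m"
      "(\<exists>r. m = const_abs r a) \<or> (\<forall>u. m \<noteq> Abs u)"
    using App.IH(1)[where \<sigma> = \<sigma> and a = a, OF st(1) App.prems(2)] st(3) by blast
  obtain n where n: "beta\<^sup>*\<^sup>* (psubst \<sigma> t) n" "normal n"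
      "(\<exists>i\<in>frees t. \<exists>r. \<sigma> i = const_abs r a) \<longrightarrow> a \<in> frees n"
    using App.IH(2)[where \<sigma> = \<sigma> and a = a, OF st(2) App.prems(2)] by blast
  have red: "beta\<^sup>*\<^sup>* (psubst \<sigma> (App s t)) (App m n)"
    using m(1) n(1) by (simp add: beta_star_App)
  show ?case
  proof (cases "\<forall>u. m \<noteq> Abs u")
    case True
    then show ?thesis using red m n by (intro exI[of _ "App m n"]) (auto simp: normal_def)
  next
    case False
    \<comment> \<open>\<open>const_abs 0 a\<close> is a variable, hence excluded for the abstraction
      \<open>m\<close>.\<close>
    then obtain r where "m = const_abs (Suc r) a"
      using m(4) by (metis const_abs_0 dB.distinct(3) not0_implies_Suc)
    then have "beta (App m n) (const_abs r a)"
      using beta_redex[of "const_abs r (Suc a)" n] by (simp add: subst_0 psubst_const_abs)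
    with red have "beta\<^sup>*\<^sup>* (psubst \<sigma> (App s t)) (const_abs r a)"
      by (rule rtranclp.rtrancl_into_rtrancl)
    then show ?thesis by (intro exI[of _ "const_abs r a"]) auto
  qed
next
  case (Abs t)
  have up: "(\<exists>r. up \<sigma> i = const_abs r (Suc a)) \<or> (\<exists>j. up \<sigma> i = Var j)" for i
  proof (cases i)
    case (Suc k)
    have "lift (const_abs r a) 0 = const_abs r (Suc a)" for r
      by (simp add: lift_0 psubst_const_abs)
    then show ?thesis using Suc Abs.prems(2)[of k] by auto
  qed simp
  have lift: "\<sigma> i = const_abs r a \<Longrightarrow> up \<sigma> (Suc i) = const_abs r (Suc a)" for i r
    by (simp add: lift_0 psubst_const_abs)
  obtain n where n: "beta\<^sup>*\<^sup>* (psubst (up \<sigma>) t) n" "normal n"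
      "(\<exists>i\<in>frees t. \<exists>r. up \<sigma> i = const_abs r (Suc a)) \<longrightarrow> Suc a \<in> frees n"
    using Abs.IH[where \<sigma> = "up \<sigma>" and a = "Suc a", OF _ up] Abs.prems(1) by (auto simp: normal_def)
  have "a \<in> frees (Abs n)" if "i \<in> frees (Abs t)" "\<sigma> i = const_abs r a" for i r
    using n(3) that lift by (metis (mono_tags) frees.simps(3) mem_Collect_eq)
  then show ?case
    using n by (intro exI[of _ "Abs n"]) (auto simp: normal_def intro: beta_star_Abs)
qed

text \<open>Once \<bottom> is replaced by O, which leaves S unchanged, each variable of \<Gamma> is
  filled by a constant function returning \<alpha> : O. The normal form of the result has type S, so
  \<alpha> is absent from it; by \<open>const_abs_normal_form\<close> the term \<open>t\<close> then
  has no free variable.\<close>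

lemma output_closed:
  assumes S: "output_type S" "1 \<notin> tcons S"
    and t: "typF \<Gamma> t S" "normal t"
    and \<Gamma>: "\<And>i. i < length \<Gamma> \<Longrightarrow> \<exists>r. typF [tyO] (const_abs r 0) (rcon (\<Gamma> ! i))"
  shows "typF [] t S"
proof -
  from \<Gamma> obtain r where r: "\<And>i. i < length \<Gamma> \<Longrightarrow> typF [tyO] (const_abs (r i) 0) (rcon (\<Gamma> ! i))"
    by metis
  let ?\<sigma> = "\<lambda>i. const_abs (r i) 0"
  obtain n where n: "beta\<^sup>*\<^sup>* (psubst ?\<sigma> t) n" "normal n"
      "(\<exists>i\<in>frees t. \<exists>r'. ?\<sigma> i = const_abs r' 0) \<longrightarrow> 0 \<in> frees n"
    using const_abs_normal_form[OF t(2), of ?\<sigma> 0] by blast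
  have "typF (map rcon \<Gamma>) t S"
    using typing_rcon[OF t(1)] S(2) by (simp add: rcon_id)
  then have "typF [tyO] (psubst ?\<sigma> t) S"
    by (rule typing_psubst) (simp add: r)
  with n(1) have "typF [tyO] n S" by (rule beta_star_typing)
  then have "0 \<notin> frees n" using S(1) n(2) by (auto simp: output_type_def)
  then have "frees t = {}" using n(3) by blast
  then show ?thesis using t(1) by (auto intro: typing_cong)
qed

subsection \<open>Typed spines\<close>

text \<open>\<open>A\<close> is the type of a head, \<open>cs\<close> its arguments and
  \<open>R\<close> the type of the application. Instantiations are interleaved with arguments and
  generalizations left out, so a spine to \<bottom> can be read off from the shape of
  \<open>A\<close>.\<close>

inductive spine :: "ty list \<Rightarrow> ty \<Rightarrow> dB list \<Rightarrow> ty \<Rightarrow> bool" for \<Gamma> where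
  spine_nil: "spine \<Gamma> A [] A"
| spine_arr: "typF \<Gamma> c B \<Longrightarrow> spine \<Gamma> C cs R \<Longrightarrow> spine \<Gamma> (Arrow B C) (c # cs) R"
| spine_inst: "proper C \<Longrightarrow> spine \<Gamma> (subst_ty A C 0) cs R \<Longrightarrow> spine \<Gamma> (All A) cs R"

text \<open>Spines grow at the head, typings of applications at the last argument; this and the next
  lemma reconcile the two.\<close>

lemma spine_snoc_arr:
  "spine \<Gamma> A cs R \<Longrightarrow> R = Arrow B C \<Longrightarrow> typF \<Gamma> c B \<Longrightarrow> spine \<Gamma> A (cs @ [c]) C"
  by (induction rule: spine.induct) (auto intro: spine.intros)

lemma spine_snoc_inst:
  "spine \<Gamma> A cs R \<Longrightarrow> R = All B \<Longrightarrow> proper C \<Longrightarrow> spine \<Gamma> A cs (subst_ty B C 0)"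
  by (induction rule: spine.induct) (auto intro: spine.intros)

lemma spine_tsubst:
  assumes "spine \<Gamma> A cs R" "\<And>i. proper (\<rho> i)"
  shows "spine (map (tsubst \<rho>) \<Gamma>) (tsubst \<rho> A) cs (tsubst \<rho> R)"
  using assms
proof (induction rule: spine.induct)
  case (spine_arr c B C cs R)
  then show ?case by (auto intro!: spine.intros typing_tsubst)
next
  case (spine_inst C A cs R)
  then have "spine (map (tsubst \<rho>) \<Gamma>) (subst_ty (tsubst (up_ty \<rho>) A) (tsubst \<rho> C) 0) cs (tsubst \<rho> R)"
    by (simp add: tsubst_subst_ty)
  then show ?case using spine_inst.hyps(1) spine_inst.prems
    by (auto intro: spine.spine_inst proper_tsubst)
qed (simp add: spine.intros)

lemma spine_append: "spine \<Gamma> A cs R \<Longrightarrow> spine (\<Gamma> @ \<Gamma>') A cs R"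
  by (induction rule: spine.induct) (auto intro: spine.intros typing_append)

lemma spine_typing: "spine \<Gamma> A cs R \<Longrightarrow> typF \<Gamma> h A \<Longrightarrow> typF \<Gamma> (foldl App h cs) R"
  by (induction arbitrary: h rule: spine.induct) (auto intro: typing.intros)

lemma spine_frees: "spine \<Gamma> A cs R \<Longrightarrow> c \<in> set cs \<Longrightarrow> i \<in> frees c \<Longrightarrow> i < length \<Gamma>"
  by (induction rule: spine.induct) (auto dest: typing_frees)

text \<open>The same device as \<open>abs_inv\<close>: stripping leading quantifiers absorbs
  generalization. At \<bottom>, the type of every state of the run, it is just a spine from the type
  of the head variable.\<close>

primrec neutral_inv :: "nat \<Rightarrow> dB list \<Rightarrow> ty list \<Rightarrow> ty \<Rightarrow> bool" where
  "neutral_inv k cs \<Gamma> (TVar i) = (k < length \<Gamma> \<and> spine \<Gamma> (\<Gamma> ! k) cs (TVar i))"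
| "neutral_inv k cs \<Gamma> (TCon c) = (k < length \<Gamma> \<and> spine \<Gamma> (\<Gamma> ! k) cs (TCon c))"
| "neutral_inv k cs \<Gamma> (Arrow A B) = (k < length \<Gamma> \<and> spine \<Gamma> (\<Gamma> ! k) cs (Arrow A B))"
| "neutral_inv k cs \<Gamma> (All A) = neutral_inv k cs (map (\<lambda>B. lift_ty B 0) \<Gamma>) A"

lemma spine_neutral_inv: "k < length \<Gamma> \<Longrightarrow> spine \<Gamma> (\<Gamma> ! k) cs A \<Longrightarrow> neutral_inv k cs \<Gamma> A"
proof (induction A arbitrary: \<Gamma>)
  case (All A)
  let ?\<Gamma> = "map (\<lambda>B. lift_ty B 0) \<Gamma>"
  have "spine (map (tsubst (\<lambda>i. TVar (Suc i))) \<Gamma>) (tsubst (\<lambda>i. TVar (Suc i)) (\<Gamma> ! k)) cs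
      (tsubst (\<lambda>i. TVar (Suc i)) (All A))"
    using All.prems(2) by (rule spine_tsubst) simp
  then have "spine ?\<Gamma> (?\<Gamma> ! k) cs (All (tsubst (up_ty (\<lambda>i. TVar (Suc i))) A))"
    using All.prems(1) by (simp add: lift_ty_0[abs_def])
  \<comment> \<open>Instantiation by the fresh variable \<open>TVar 0\<close> undoes the shift and
    recovers \<open>A\<close>.\<close>
  then have "spine ?\<Gamma> (?\<Gamma> ! k) cs (subst_ty (tsubst (up_ty (\<lambda>i. TVar (Suc i))) A) (TVar 0) 0)"
    by (rule spine_snoc_inst) auto
  moreover have "case_nat (TVar 0) (\<lambda>i. TVar (Suc i)) = TVar"
    by (auto split: nat.split)
  ultimately have "spine ?\<Gamma> (?\<Gamma> ! k) cs A"
    by (simp only: subst_ty_up) simp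
  then show ?case using All by simp
qed simp_all

lemma neutral_inv_tsubst:
  assumes "neutral_inv k cs \<Gamma> A" "\<And>i. proper (\<rho> i)"
  shows "neutral_inv k cs (map (tsubst \<rho>) \<Gamma>) (tsubst \<rho> A)"
  using assms
proof (induction A arbitrary: \<Gamma> \<rho>)
  case (All A)
  have "proper (up_ty \<rho> i)" for i
    using All.prems(2) by (auto simp: lift_ty_0 intro: proper_tsubst split: nat.split)
  then have "neutral_inv k cs (map (tsubst (up_ty \<rho>)) (map (\<lambda>B. lift_ty B 0) \<Gamma>)) (tsubst (up_ty \<rho>) A)"
    using All.prems(1) by (intro All.IH) simp_all
  then show ?case unfolding map_tsubst_lift by simp
next
  case (TVar i)
  then have k: "k < length \<Gamma>" "spine \<Gamma> (\<Gamma> ! k) cs (TVar i)" by auto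
  show ?case using spine_tsubst[OF k(2) TVar.prems(2)] k(1) by (intro spine_neutral_inv) simp_all
next
  case (TCon i)
  then have k: "k < length \<Gamma>" "spine \<Gamma> (\<Gamma> ! k) cs (TCon i)" by auto
  show ?case using spine_tsubst[OF k(2) TCon.prems(2)] k(1) by (intro spine_neutral_inv) simp_all
next
  case (Arrow B C)
  then have k: "k < length \<Gamma>" "spine \<Gamma> (\<Gamma> ! k) cs (Arrow B C)" by auto
  show ?case using spine_tsubst[OF k(2) Arrow.prems(2)] k(1) by (intro spine_neutral_inv) simp_all
qed

lemma typing_neutral_inv:
  assumes "typing b \<Gamma> u A" "b" "u = foldl App (Var k) cs"
  shows "neutral_inv k cs \<Gamma> A"
  using assms
proof (induction arbitrary: cs rule: typing.induct)
  case (ax i \<Gamma> b)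
  then have "cs = [] \<and> k = i" by (cases cs rule: rev_cases) auto
  then show ?case using ax by (auto intro!: spine_neutral_inv spine.intros)
next
  case (arr_i B b \<Gamma> t C)
  then show ?case by (cases cs rule: rev_cases) auto
next
  case (arr_e b \<Gamma> u B C v)
  then obtain cs' where cs: "cs = cs' @ [v]" "u = foldl App (Var k) cs'"
    by (cases cs rule: rev_cases) auto
  with arr_e have "k < length \<Gamma>" "spine \<Gamma> (\<Gamma> ! k) cs' (Arrow B C)" by auto
  then show ?case using cs arr_e by (auto intro!: spine_neutral_inv spine_snoc_arr)
next
  case (all_i A b \<Gamma> t)
  then show ?case by simp
next
  case (all_e b C \<Gamma> t A)
  then have "neutral_inv k cs (map (\<lambda>B. lift_ty B 0) \<Gamma>) A" by simp
  then have "neutral_inv k cs (map (tsubst (case_nat C TVar)) (map (\<lambda>B. lift_ty B 0) \<Gamma>))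
      (tsubst (case_nat C TVar) A)"
    by (rule neutral_inv_tsubst) (use all_e.hyps in \<open>simp split: nat.split\<close>)
  then show ?case unfolding map_tsubst_scons_lift subst_ty_0 .
qed

lemma spine_Arrow_tyBotE:
  assumes "spine \<Gamma> (Arrow A B) cs tyBot"
  obtains c cs' where "cs = c # cs'" "typF \<Gamma> c A" "spine \<Gamma> B cs' tyBot"
  using assms by (cases rule: spine.cases) (auto simp: tyBot_def)

lemma spine_All_tyBotE:
  assumes "spine \<Gamma> (All A) cs tyBot"
  obtains C where "proper C" "spine \<Gamma> (subst_ty A C 0) cs tyBot"
  using assms by (cases rule: spine.cases) (auto simp: tyBot_def)

lemma spine_TCon_iff: "spine \<Gamma> (TCon c) cs R \<longleftrightarrow> cs = [] \<and> R = TCon c"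
  by (auto elim: spine.cases intro: spine.intros)

subsection \<open>Head reduction with suspended closures\<close>

text \<open>Variable \<open>0\<close> is \<open>f\<close>; variable \<open>Suc k\<close> stands for the closure \<open>D ! k = (b, as)\<close>, a subterm \<open>b\<close> of
  \<open>t\<^sub>0\<close> with \<open>as\<close> for its free variables, and \<open>as\<close> only mentions earlier variables. Fresh variables go
  to the end of the context, so no term is ever lifted.\<close>

definition wf_clos :: "ty list \<Rightarrow> dB \<Rightarrow> dB list \<Rightarrow> ty \<Rightarrow> bool" where
  "wf_clos \<Gamma> b as A \<longleftrightarrow> (\<exists>\<Delta> B \<rho>. typF0 \<Delta> b B \<and> proper B \<and> A = tsubst \<rho> (goedel B) \<and> (\<forall>i. proper (\<rho> i))
     \<and> (\<forall>C\<in>set \<Delta>. proper C) \<and> length as = length \<Delta>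
     \<and> (\<forall>i<length \<Delta>. typF \<Gamma> (as ! i) (tsubst \<rho> (goedel (\<Delta> ! i)))))"

text \<open>\<open>take (Suc k) \<Gamma>\<close> holds the type of \<open>f\<close> and those of the
  \<open>k\<close> older closures; this order is what makes indices drop on unfolding.\<close>

definition wf_env :: "ty list \<Rightarrow> (dB \<times> dB list) list \<Rightarrow> bool" where
  "wf_env \<Gamma> D \<longleftrightarrow> length \<Gamma> = Suc (length D)
     \<and> (\<forall>k<length D. wf_clos (take (Suc k) \<Gamma>) (fst (D ! k)) (snd (D ! k)) (\<Gamma> ! Suc k))"

text \<open>The actual run, from some \<open>\<theta> \<simeq>\<^sub>\<beta> t\<^sub>0\<close>, has \<open>\<beta>\<close> in place of \<open>b\<close>. The substitution \<open>\<eta>\<close> is unconstrained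
  beyond \<open>as\<close>, since \<open>\<theta>\<close> may have free variables that \<open>t\<^sub>0\<close> has not.\<close>

definition realizes :: "(nat \<Rightarrow> dB) \<Rightarrow> (nat \<Rightarrow> dB) \<Rightarrow> dB \<Rightarrow> dB \<Rightarrow> dB list \<Rightarrow> bool" where
  "realizes \<sigma> \<eta> \<beta> b as \<longleftrightarrow> st \<beta> b \<and> (\<forall>i<length as. \<eta> i = psubst \<sigma> (as ! i))"

text \<open>No condition is put on \<open>\<sigma> 0\<close>, the value of \<open>f\<close>. Closure
  values are existential so that one symbolic run covers every \<theta>.\<close>

definition instantiates :: "(dB \<times> dB list) list \<Rightarrow> (nat \<Rightarrow> dB) \<Rightarrow> bool" where
  "instantiates D \<sigma> \<longleftrightarrow> (\<forall>k<length D. \<exists>\<eta> \<beta>. realizes \<sigma> \<eta> \<beta> (fst (D ! k)) (snd (D ! k)) \<and> \<sigma> (Suc k) = psubst \<eta> \<beta>)"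

lemma wf_clos_frees: "wf_clos \<Gamma> b as A \<Longrightarrow> i < length as \<Longrightarrow> j \<in> frees (as ! i) \<Longrightarrow> j < length \<Gamma>"
  unfolding wf_clos_def using typing_frees by metis

lemma wf_env_snoc:
  assumes "wf_env \<Gamma> D" "wf_clos \<Gamma> b as A"
  shows "wf_env (\<Gamma> @ [A]) (D @ [(b, as)])"
  using assms by (auto simp: wf_env_def nth_append less_Suc_eq)

text \<open>Older closures mention only variables below \<open>length \<Gamma>\<close>, so giving
  that index a value leaves their realizations intact.\<close>

lemma instantiates_snoc:
  assumes "wf_env \<Gamma> D" "instantiates D \<sigma>" "\<And>i. i < length as \<Longrightarrow> frees (as ! i) \<subseteq> {..<length \<Gamma>}"
    and "realizes \<sigma> \<eta> \<beta> b as"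
  shows "instantiates (D @ [(b, as)]) (\<sigma>(length \<Gamma> := psubst \<eta> \<beta>))"
proof -
  let ?\<sigma> = "\<sigma>(length \<Gamma> := psubst \<eta> \<beta>)"
  have len: "length \<Gamma> = Suc (length D)" using assms(1) by (simp add: wf_env_def)
  have eq: "psubst ?\<sigma> a = psubst \<sigma> a" if "frees a \<subseteq> {..<length \<Gamma>}" for a
    by (rule psubst_cong) (use that in auto)
  have "realizes ?\<sigma> \<eta> \<beta> b as"
    using assms(3,4) eq by (auto simp: realizes_def)
  moreover have "realizes ?\<sigma> \<eta>' \<beta>' (fst (D ! k)) (snd (D ! k))"
    if k: "k < length D" and r: "realizes \<sigma> \<eta>' \<beta>' (fst (D ! k)) (snd (D ! k))" for k \<eta>' \<beta>'
  proof -
    have wf: "wf_clos (take (Suc k) \<Gamma>) (fst (D ! k)) (snd (D ! k)) (\<Gamma> ! Suc k)"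
      using assms(1) k by (simp add: wf_env_def)
    have "frees (snd (D ! k) ! i) \<subseteq> {..<length \<Gamma>}" if "i < length (snd (D ! k))" for i
      using wf_clos_frees[OF wf that] by auto
    then show ?thesis using r eq by (auto simp: realizes_def)
  qed
  ultimately show ?thesis
    using assms(2) unfolding instantiates_def
    by (auto simp: nth_append less_Suc_eq len) blast+
qed

text \<open>If no head step is made, \<open>u\<close> starts with one of the \<open>as\<close>, whose head variable is older than the
  variable being unfolded: this is what makes the run terminate.\<close>

definition resumes ::
  "(dB \<times> dB list) list \<Rightarrow> (dB \<times> dB list) list \<Rightarrow> dB list \<Rightarrow> dB \<Rightarrow> dB list \<Rightarrow> dB \<Rightarrow> bool" where
  "resumes D D' as t cs u \<longleftrightarrow> (\<forall>\<sigma> \<eta> \<beta>. instantiates D \<sigma> \<longrightarrow> realizes \<sigma> \<eta> \<beta> t as \<longrightarrow>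
     (\<exists>\<sigma>'. (\<forall>j\<le>length D. \<sigma>' j = \<sigma> j) \<and> instantiates (D @ D') \<sigma>' \<and>
       (whr\<^sup>+\<^sup>+ (foldl App (psubst \<eta> \<beta>) (map (psubst \<sigma>) cs)) (psubst \<sigma>' u) \<or>
        whr\<^sup>*\<^sup>* (foldl App (psubst \<eta> \<beta>) (map (psubst \<sigma>) cs)) (psubst \<sigma>' u) \<and>
        (\<exists>i<length as. \<exists>cs'. u = foldl App (as ! i) cs'))))"

lemma resumesD:
  assumes "resumes D D' as t cs u" "instantiates D \<sigma>" "realizes \<sigma> \<eta> \<beta> t as"
  obtains \<sigma>' where "\<forall>j\<le>length D. \<sigma>' j = \<sigma> j" "instantiates (D @ D') \<sigma>'"
    "whr\<^sup>+\<^sup>+ (foldl App (psubst \<eta> \<beta>) (map (psubst \<sigma>) cs)) (psubst \<sigma>' u) \<or>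
     whr\<^sup>*\<^sup>* (foldl App (psubst \<eta> \<beta>) (map (psubst \<sigma>) cs)) (psubst \<sigma>' u) \<and>
     (\<exists>i<length as. \<exists>cs'. u = foldl App (as ! i) cs')"
  using assms unfolding resumes_def by blast

text \<open>By induction on the derivation of \<open>t\<close>: an application pushes its argument as a fresh suspended
  variable, an abstraction pops an argument of the spine, which the type \<open>\<bottom>\<close> guarantees to exist.\<close>

lemma suspended_step:
  assumes "typing b \<Delta> t B" "\<not> b"
    and "\<And>C. C \<in> set \<Delta> \<Longrightarrow> proper C" "\<And>i. proper (\<rho> i)"
    and "length as = length \<Delta>"
    and "\<And>i. i < length \<Delta> \<Longrightarrow> typF \<Gamma> (as ! i) (tsubst \<rho> (goedel (\<Delta> ! i)))"
    and "wf_env \<Gamma> D" "spine \<Gamma> (tsubst \<rho> (goedel B)) cs tyBot"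
  shows "\<exists>\<Gamma>' D' u. wf_env (\<Gamma> @ \<Gamma>') (D @ D') \<and> typF (\<Gamma> @ \<Gamma>') u tyBot \<and> resumes D D' as t cs u"
  using assms
proof (induction arbitrary: \<rho> as \<Gamma> D cs rule: typing.induct)
  case (ax i \<Delta> b)
  let ?u = "foldl App (as ! i) cs"
  have "typF \<Gamma> ?u tyBot"
    using ax by (blast intro: spine_typing)
  moreover have "whr\<^sup>*\<^sup>* (foldl App (psubst \<eta> \<beta>) (map (psubst \<sigma>) cs)) (psubst \<sigma> ?u)"
    if "realizes \<sigma> \<eta> \<beta> (Var i) as" for \<sigma> \<eta> \<beta>
  proof -
    have "whr\<^sup>*\<^sup>* \<beta> (Var i)" using that by (auto simp: realizes_def elim: st_VarE)
    then have "whr\<^sup>*\<^sup>* (psubst \<eta> \<beta>) (psubst \<eta> (Var i))" by (rule whr_star_psubst)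
    also have "psubst \<eta> (Var i) = psubst \<sigma> (as ! i)"
      using that ax by (simp add: realizes_def)
    finally show ?thesis by (simp add: psubst_foldl_App whr_star_foldl)
  qed
  moreover have "i < length as" using ax by simp
  \<comment> \<open>Possibly no head step occurs here, but \<open>?u\<close> is headed by
    \<open>as ! i\<close>, which is the second alternative.\<close>
  ultimately have "resumes D [] as (Var i) cs ?u"
    unfolding resumes_def append_Nil2 by blast
  with \<open>typF \<Gamma> ?u tyBot\<close> ax.prems(6) show ?case
    by (intro exI[of _ "[]"] exI[of _ ?u]) simp
next
  case (arr_i B b \<Delta> t C)
  from arr_i.prems(7) obtain c cs' where cs: "cs = c # cs'" "typF \<Gamma> c (tsubst \<rho> (goedel B))"
      "spine \<Gamma> (tsubst \<rho> (goedel C)) cs' tyBot"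
    by (auto elim: spine_Arrow_tyBotE)
  have typed: "typF \<Gamma> ((c # as) ! i) (tsubst \<rho> (goedel ((B # \<Delta>) ! i)))" if "i < length (B # \<Delta>)" for i
    using that cs(2) arr_i.prems(5) by (cases i) auto
  have props: "proper A" if "A \<in> set (B # \<Delta>)" for A
    using that arr_i.hyps(1) arr_i.prems(2) by auto
  have len: "length (c # as) = length (B # \<Delta>)" using arr_i.prems(4) by simp
  obtain \<Gamma>' D' u where u: "wf_env (\<Gamma> @ \<Gamma>') (D @ D')" "typF (\<Gamma> @ \<Gamma>') u tyBot"
    and step: "resumes D D' (c # as) t cs' u"
    using arr_i.IH[OF arr_i.prems(1) props arr_i.prems(3) len typed arr_i.prems(6) cs(3)] by blast
  \<comment> \<open>Popping an argument contracts a redex, so the strict alternative holds whatever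
    the body does.\<close>
  have "\<exists>\<sigma>'. (\<forall>j\<le>length D. \<sigma>' j = \<sigma> j) \<and> instantiates (D @ D') \<sigma>' \<and>
      whr\<^sup>+\<^sup>+ (foldl App (psubst \<eta> \<beta>) (map (psubst \<sigma>) cs)) (psubst \<sigma>' u)"
    if \<sigma>: "instantiates D \<sigma>" and r: "realizes \<sigma> \<eta> \<beta> (Abs t) as" for \<sigma> \<eta> \<beta>
  proof -
    from r obtain \<beta>' where \<beta>': "whr\<^sup>*\<^sup>* \<beta> (Abs \<beta>')" "st \<beta>' t"
      by (auto simp: realizes_def elim: st_AbsE)
    let ?c = "psubst \<sigma> c" and ?\<eta> = "case_nat (psubst \<sigma> c) \<eta>"
    have "realizes \<sigma> ?\<eta> \<beta>' t (c # as)"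
      using r \<beta>'(2) by (auto simp: realizes_def nth_Cons split: nat.split)
    then obtain \<sigma>' where \<sigma>': "\<forall>j\<le>length D. \<sigma>' j = \<sigma> j" "instantiates (D @ D') \<sigma>'"
        "whr\<^sup>*\<^sup>* (foldl App (psubst ?\<eta> \<beta>') (map (psubst \<sigma>) cs')) (psubst \<sigma>' u)"
      by (rule resumesD[OF step \<sigma>]) (auto dest: tranclp_into_rtranclp)
    have "whr\<^sup>*\<^sup>* (App (psubst \<eta> \<beta>) ?c) (App (psubst \<eta> (Abs \<beta>')) ?c)"
      by (intro whr_star_App whr_star_psubst \<beta>')
    moreover have "whr (App (psubst \<eta> (Abs \<beta>')) ?c) (psubst ?\<eta> \<beta>')"
      using whr_redex[of "psubst (up \<eta>) \<beta>'" ?c] by (simp add: subst_psubst_up)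
    ultimately have "whr\<^sup>*\<^sup>* (foldl App (psubst \<eta> \<beta>) (map (psubst \<sigma>) cs))
        (foldl App (App (psubst \<eta> (Abs \<beta>')) ?c) (map (psubst \<sigma>) cs'))"
      and "whr (foldl App (App (psubst \<eta> (Abs \<beta>')) ?c) (map (psubst \<sigma>) cs'))
        (foldl App (psubst ?\<eta> \<beta>') (map (psubst \<sigma>) cs'))"
      using cs(1) by (auto intro: whr_star_foldl whr_foldl simp del: psubst_Abs)
    then have "whr\<^sup>+\<^sup>+ (foldl App (psubst \<eta> \<beta>) (map (psubst \<sigma>) cs))
        (foldl App (psubst ?\<eta> \<beta>') (map (psubst \<sigma>) cs'))"
      by (rule rtranclp_into_tranclp1)
    then have "whr\<^sup>+\<^sup>+ (foldl App (psubst \<eta> \<beta>) (map (psubst \<sigma>) cs)) (psubst \<sigma>' u)"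
      using \<sigma>'(3) by (rule tranclp_rtranclp_tranclp)
    with \<sigma>'(1,2) show ?thesis by blast
  qed
  then have "resumes D D' as (Abs t) cs u"
    unfolding resumes_def by blast
  with u show ?case by blast
next
  case (arr_e b \<Delta> p B C q)
  let ?A = "tsubst \<rho> (goedel B)"
  have "proper (Arrow B C)" using arr_e.hyps(1) arr_e.prems(2) by (rule typing_proper)
  then have clos: "wf_clos \<Gamma> q as ?A"
    using arr_e unfolding wf_clos_def by (intro exI[of _ \<Delta>] exI[of _ B] exI[of _ \<rho>]) auto
  have len\<Gamma>: "length \<Gamma> = Suc (length D)" using arr_e.prems(6) by (simp add: wf_env_def)
  let ?\<Gamma> = "\<Gamma> @ [?A]" and ?D = "D @ [(q, as)]"
  have env: "wf_env ?\<Gamma> ?D" using arr_e.prems(6) clos by (rule wf_env_snoc)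
  have typed: "typF ?\<Gamma> (as ! i) (tsubst \<rho> (goedel (\<Delta> ! i)))" if "i < length \<Delta>" for i
    using arr_e.prems(5)[OF that] by (rule typing_append)
  have "typF ?\<Gamma> (Var (length \<Gamma>)) ?A"
    using typing.ax[of "length \<Gamma>" ?\<Gamma> True] by simp
  then have sp: "spine ?\<Gamma> (tsubst \<rho> (goedel (Arrow B C))) (Var (length \<Gamma>) # cs) tyBot"
    using arr_e.prems(7) by (auto intro: spine_arr spine_append)
  obtain \<Gamma>' D' u where u: "wf_env (?\<Gamma> @ \<Gamma>') (?D @ D')" "typF (?\<Gamma> @ \<Gamma>') u tyBot"
    and step: "resumes ?D D' as p (Var (length \<Gamma>) # cs) u"
    using arr_e.IH(1)[OF arr_e.prems(1-4) typed env sp] by blast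
  have frees_as: "frees (as ! i) \<subseteq> {..<length \<Gamma>}" if "i < length as" for i
    using wf_clos_frees[OF clos that] by auto
  have "\<exists>\<sigma>'. (\<forall>j\<le>length D. \<sigma>' j = \<sigma> j) \<and> instantiates (?D @ D') \<sigma>' \<and>
      (whr\<^sup>+\<^sup>+ (foldl App (psubst \<eta> \<beta>) (map (psubst \<sigma>) cs)) (psubst \<sigma>' u) \<or>
       whr\<^sup>*\<^sup>* (foldl App (psubst \<eta> \<beta>) (map (psubst \<sigma>) cs)) (psubst \<sigma>' u) \<and>
       (\<exists>i<length as. \<exists>cs'. u = foldl App (as ! i) cs'))"
    if \<sigma>: "instantiates D \<sigma>" and r: "realizes \<sigma> \<eta> \<beta> (App p q) as" for \<sigma> \<eta> \<beta>
  proof -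
    from r obtain \<beta>1 \<beta>2 where \<beta>: "whr\<^sup>*\<^sup>* \<beta> (App \<beta>1 \<beta>2)" "st \<beta>1 p" "st \<beta>2 q"
      by (auto simp: realizes_def elim: st_AppE)
    let ?\<sigma> = "\<sigma>(length \<Gamma> := psubst \<eta> \<beta>2)"
    have eq: "psubst ?\<sigma> a = psubst \<sigma> a" if "frees a \<subseteq> {..<length \<Gamma>}" for a
      by (rule psubst_cong) (use that in auto)
    have "realizes \<sigma> \<eta> \<beta>2 q as" using r \<beta>(3) by (simp add: realizes_def)
    then have "instantiates ?D ?\<sigma>"
      using instantiates_snoc[OF arr_e.prems(6) \<sigma> frees_as] by blast
    moreover have "realizes ?\<sigma> \<eta> \<beta>1 p as"
      using r \<beta>(2) eq[OF frees_as] by (simp add: realizes_def)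
    ultimately obtain \<sigma>' where \<sigma>': "\<forall>j\<le>length ?D. \<sigma>' j = ?\<sigma> j" "instantiates (?D @ D') \<sigma>'"
      and red: "whr\<^sup>+\<^sup>+ (foldl App (psubst \<eta> \<beta>1) (map (psubst ?\<sigma>) (Var (length \<Gamma>) # cs))) (psubst \<sigma>' u) \<or>
         whr\<^sup>*\<^sup>* (foldl App (psubst \<eta> \<beta>1) (map (psubst ?\<sigma>) (Var (length \<Gamma>) # cs))) (psubst \<sigma>' u) \<and>
         (\<exists>i<length as. \<exists>cs'. u = foldl App (as ! i) cs')"
      by (rule resumesD[OF step]) blast
    have "map (psubst ?\<sigma>) cs = map (psubst \<sigma>) cs"
      using spine_frees[OF arr_e.prems(7)] by (intro map_cong refl eq subsetI) auto
    then have args: "foldl App (psubst \<eta> \<beta>1) (map (psubst ?\<sigma>) (Var (length \<Gamma>) # cs))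
        = foldl App (psubst \<eta> (App \<beta>1 \<beta>2)) (map (psubst \<sigma>) cs)"
      by (simp del: map_eq_conv)
    have start: "whr\<^sup>*\<^sup>* (foldl App (psubst \<eta> \<beta>) (map (psubst \<sigma>) cs))
        (foldl App (psubst \<eta> (App \<beta>1 \<beta>2)) (map (psubst \<sigma>) cs))"
      by (intro whr_star_foldl whr_star_psubst \<beta>(1))
    have "\<forall>j\<le>length D. \<sigma>' j = \<sigma> j" using \<sigma>'(1) len\<Gamma> by simp
    moreover have "whr\<^sup>+\<^sup>+ (foldl App (psubst \<eta> \<beta>) (map (psubst \<sigma>) cs)) (psubst \<sigma>' u) \<or>
       whr\<^sup>*\<^sup>* (foldl App (psubst \<eta> \<beta>) (map (psubst \<sigma>) cs)) (psubst \<sigma>' u) \<and>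
       (\<exists>i<length as. \<exists>cs'. u = foldl App (as ! i) cs')"
      using red start unfolding args by (blast intro: rtranclp_trans rtranclp_tranclp_tranclp)
    ultimately show ?thesis using \<sigma>'(2) by blast
  qed
  then have "resumes D ((q, as) # D') as (App p q) cs u"
    unfolding resumes_def by simp
  with u show ?case
    by (intro exI[of _ "?A # \<Gamma>'"] exI[of _ "(q, as) # D'"] exI[of _ u]) simp
next
  case (all_i A b \<Delta> t)
  from all_i.prems(7) obtain C where C: "proper C"
      "spine \<Gamma> (subst_ty (tsubst (up_ty \<rho>) (goedel A)) C 0) cs tyBot"
    by (auto elim: spine_All_tyBotE)
  \<comment> \<open>The type \<open>C\<close> chosen by the spine becomes the value of the
    quantified variable; the lifted types of \<Delta> do not see it.\<close>
  let ?\<rho> = "case_nat C \<rho>" and ?\<Delta> = "map (\<lambda>B. lift_ty B 0) \<Delta>"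
  have props: "proper B" if "B \<in> set ?\<Delta>" for B
    using that all_i.prems(2) by (auto simp: lift_ty_0 intro: proper_tsubst)
  have proper\<rho>: "proper (?\<rho> i)" for i using C(1) all_i.prems(3) by (simp split: nat.split)
  have len: "length as = length ?\<Delta>" using all_i.prems(4) by simp
  have typed: "typF \<Gamma> (as ! i) (tsubst ?\<rho> (goedel (?\<Delta> ! i)))" if "i < length ?\<Delta>" for i
    using that all_i.prems(5) by (simp add: goedel_lift tsubst_scons_lift)
  have sp: "spine \<Gamma> (tsubst ?\<rho> (goedel A)) cs tyBot"
    using C(2) by (simp add: subst_ty_up)
  show ?case
    by (rule all_i.IH[OF all_i.prems(1) props proper\<rho> len typed all_i.prems(6) sp])
next
  case (all_e b C \<Delta> t A)
  \<comment> \<open>Excluded by the flag: here the restriction to F0 enters.\<close>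
  then show ?case by simp
qed

section \<open>Termination of the symbolic run\<close>

primrec head_var :: "dB \<Rightarrow> nat" where
  "head_var (Var i) = i"
| "head_var (App s t) = head_var s"
| "head_var (Abs t) = 0"

lemma head_var_foldl [simp]: "head_var (foldl App h cs) = head_var h"
  by (induction cs arbitrary: h) auto

text \<open>The default 0 for abstractions lies below every closure variable \<open>Suc j\<close>,
  so a frozen argument headed by an abstraction also decreases the index.\<close>

lemma head_var_frees: "head_var t \<in> frees t \<or> head_var t = 0"
  by (induction t) auto

lemma whr_cases: "(\<exists>u. whr t u) \<or> (\<exists>k cs. t = foldl App (Var k) cs) \<or> (\<exists>u. t = Abs u)"
proof (induction t)
  case (Var i)
  have "Var i = foldl App (Var i) []" by simp
  then show ?case by blast
next
  case (App s t)
  have "App (foldl App (Var k) cs) t = foldl App (Var k) (cs @ [t])" for k cs by simp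
  then show ?case using App.IH(1) by (metis whr.intros)
qed simp

text \<open>Lexicographic induction on the bound for a reference instance
  \<open>\<sigma>\<^sub>0\<close>, then on the index of the head variable: each unfolding makes a
  head step in that instance or passes to an older head. The symbolic states do not depend on
  \<sigma>, so one \<tau> serves all instances.\<close>

lemma head_reduction_to_output:
  assumes "wf_env \<Gamma> D" "typF \<Gamma> u tyBot" "\<Gamma> ! 0 = neg S"
    and "instantiates D \<sigma>\<^sub>0" "whr_bound N (psubst \<sigma>\<^sub>0 u)"
  shows "\<exists>\<Gamma>' D' \<tau>. wf_env (\<Gamma> @ \<Gamma>') (D @ D') \<and> typF (\<Gamma> @ \<Gamma>') \<tau> S \<and>
    (\<forall>\<sigma>. instantiates D \<sigma> \<longrightarrow> (\<exists>\<sigma>'. whr\<^sup>*\<^sup>* (psubst \<sigma> u) (App (\<sigma> 0) (psubst \<sigma>' \<tau>))))"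
  using assms
proof (induction N arbitrary: \<Gamma> D u \<sigma>\<^sub>0 rule: less_induct)
  case (less N)
  note outer = less.IH
  from less.prems show ?case
  proof (induction "head_var u" arbitrary: \<Gamma> D u \<sigma>\<^sub>0 rule: less_induct)
    case less
    have pos: "0 < length \<Gamma>" using less.prems(1) by (simp add: wf_env_def)
    consider u' where "whr u u'" | k cs where "u = foldl App (Var k) cs" | t where "u = Abs t"
      using whr_cases by blast
    then show ?case
    proof cases
      case (1 u')
      then have "whr\<^sup>+\<^sup>+ (psubst \<sigma>\<^sub>0 u) (psubst \<sigma>\<^sub>0 u')" by (blast intro: whr_psubst)
      with less.prems(5) obtain N' where N': "N' < N" "whr_bound N' (psubst \<sigma>\<^sub>0 u')"
        using whr_bound_plus by blast
      have "typF \<Gamma> u' tyBot" using less.prems(2) 1 whr_imp_beta beta_typing by blast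
      from outer[OF N'(1) less.prems(1) this less.prems(3,4) N'(2)] show ?thesis
        using 1 by (meson converse_rtranclp_into_rtranclp whr_psubst)
    next
      case (2 k cs)
      have "neutral_inv k cs \<Gamma> tyBot"
        using typing_neutral_inv[OF less.prems(2) TrueI 2] .
      then have k: "k < length \<Gamma>" "spine \<Gamma> (\<Gamma> ! k) cs tyBot" by (auto simp: tyBot_def)
      show ?thesis
      proof (cases k)
        case 0
        \<comment> \<open>\<open>f\<close> has come to the head: a spine from \<open>neg S\<close>
          to \<bottom> has exactly one argument, the \<tau> sought.\<close>
        then have "spine \<Gamma> (Arrow S (TCon 1)) cs tyBot"
          using k(2) less.prems(3) by (simp add: neg_def tyBot_def)
        then obtain \<tau> where "cs = [\<tau>]" "typF \<Gamma> \<tau> S"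
          by (auto elim!: spine_Arrow_tyBotE simp: spine_TCon_iff)
        then show ?thesis
          using less.prems(1) 2 0
          by (intro exI[of _ "[]"] exI[of _ \<tau>]) auto
      next
        case (Suc j)
        then have j: "j < length D" using k(1) less.prems(1) by (simp add: wf_env_def)
        obtain b as where Dj: "D ! j = (b, as)" by fastforce
        then have clos: "wf_clos (take (Suc j) \<Gamma>) b as (\<Gamma> ! Suc j)"
          using less.prems(1) j by (auto simp: wf_env_def)
        then obtain \<Delta> B \<rho> where b: "typF0 \<Delta> b B" "\<Gamma> ! Suc j = tsubst \<rho> (goedel B)"
            "\<And>i. proper (\<rho> i)" "\<And>C. C \<in> set \<Delta> \<Longrightarrow> proper C" "length as = length \<Delta>"
          and as: "\<And>i. i < length \<Delta> \<Longrightarrow> typF (take (Suc j) \<Gamma>) (as ! i) (tsubst \<rho> (goedel (\<Delta> ! i)))"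
          by (auto simp: wf_clos_def)
        have typed: "typF \<Gamma> (as ! i) (tsubst \<rho> (goedel (\<Delta> ! i)))" if "i < length \<Delta>" for i
          using typing_append[OF as[OF that], of "drop (Suc j) \<Gamma>"] by simp
        have sp: "spine \<Gamma> (tsubst \<rho> (goedel B)) cs tyBot" using k(2) Suc b(2) by simp
        obtain \<Gamma>1 D1 u1 where u1: "wf_env (\<Gamma> @ \<Gamma>1) (D @ D1)" "typF (\<Gamma> @ \<Gamma>1) u1 tyBot"
          and step: "resumes D D1 as b cs u1"
          using suspended_step[OF b(1) _ b(4) b(3) b(5) typed less.prems(1) sp] by blast
        \<comment> \<open>The next state \<open>u1\<close> is fixed before \<sigma>; only the values
          of new variables depend on \<sigma>.\<close>
        have step': "\<exists>\<sigma>'. \<sigma>' 0 = \<sigma> 0 \<and> instantiates (D @ D1) \<sigma>' \<and>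
              (whr\<^sup>+\<^sup>+ (psubst \<sigma> u) (psubst \<sigma>' u1) \<or>
               whr\<^sup>*\<^sup>* (psubst \<sigma> u) (psubst \<sigma>' u1) \<and>
               (\<exists>i<length as. \<exists>cs'. u1 = foldl App (as ! i) cs'))"
          if \<sigma>: "instantiates D \<sigma>" for \<sigma>
        proof -
          from \<sigma> j Dj obtain \<eta> \<beta> where "realizes \<sigma> \<eta> \<beta> b as" "\<sigma> k = psubst \<eta> \<beta>"
            unfolding instantiates_def Suc by fastforce
          then have r: "realizes \<sigma> \<eta> \<beta> b as"
            and eq: "psubst \<sigma> u = foldl App (psubst \<eta> \<beta>) (map (psubst \<sigma>) cs)"
            using 2 by (simp_all add: psubst_foldl_App)
          show ?thesis
            by (rule resumesD[OF step \<sigma> r]) (unfold eq, blast)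
        qed
        obtain \<sigma>1 where \<sigma>1: "instantiates (D @ D1) \<sigma>1"
              "whr\<^sup>+\<^sup>+ (psubst \<sigma>\<^sub>0 u) (psubst \<sigma>1 u1) \<or>
               whr\<^sup>*\<^sup>* (psubst \<sigma>\<^sub>0 u) (psubst \<sigma>1 u1) \<and>
               (\<exists>i<length as. \<exists>cs'. u1 = foldl App (as ! i) cs')"
          using step'[OF less.prems(4)] by blast
        have \<Gamma>0: "(\<Gamma> @ \<Gamma>1) ! 0 = neg S" using less.prems(3) pos by (simp add: nth_append)
        have "\<exists>\<Gamma>' D' \<tau>. wf_env ((\<Gamma> @ \<Gamma>1) @ \<Gamma>') ((D @ D1) @ D') \<and> typF ((\<Gamma> @ \<Gamma>1) @ \<Gamma>') \<tau> S \<and>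
            (\<forall>\<sigma>. instantiates (D @ D1) \<sigma> \<longrightarrow>
              (\<exists>\<sigma>'. whr\<^sup>*\<^sup>* (psubst \<sigma> u1) (App (\<sigma> 0) (psubst \<sigma>' \<tau>))))"
          using \<sigma>1(2)
        proof
          assume "whr\<^sup>+\<^sup>+ (psubst \<sigma>\<^sub>0 u) (psubst \<sigma>1 u1)"
          with less.prems(5) obtain N' where N': "N' < N" "whr_bound N' (psubst \<sigma>1 u1)"
            using whr_bound_plus by blast
          show ?thesis by (rule outer[OF N'(1) u1 \<Gamma>0 \<sigma>1(1) N'(2)])
        next
          assume *: "whr\<^sup>*\<^sup>* (psubst \<sigma>\<^sub>0 u) (psubst \<sigma>1 u1) \<and>
               (\<exists>i<length as. \<exists>cs'. u1 = foldl App (as ! i) cs')"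
          then have "whr_bound N (psubst \<sigma>1 u1)"
            using less.prems(5) whr_bound_star by blast
          moreover from * obtain i cs' where i: "i < length as" "u1 = foldl App (as ! i) cs'" by blast
          \<comment> \<open>The head index of \<open>as ! i\<close> is that of a free variable,
            hence older than \<open>Suc j\<close>, or the default 0.\<close>
          have "head_var (as ! i) < Suc j"
            using head_var_frees[of "as ! i"] wf_clos_frees[OF clos i(1)] by fastforce
          then have "head_var u1 < head_var u" using i 2 Suc by simp
          ultimately show ?thesis
            using less.hyps u1 \<Gamma>0 \<sigma>1(1) by blast
        qed
        then obtain \<Gamma>2 D2 \<tau> where \<tau>: "wf_env (\<Gamma> @ (\<Gamma>1 @ \<Gamma>2)) (D @ (D1 @ D2))" "typF (\<Gamma> @ (\<Gamma>1 @ \<Gamma>2)) \<tau> S"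
          "\<And>\<sigma>. instantiates (D @ D1) \<sigma> \<Longrightarrow> \<exists>\<sigma>'. whr\<^sup>*\<^sup>* (psubst \<sigma> u1) (App (\<sigma> 0) (psubst \<sigma>' \<tau>))"
          by auto
        have "\<exists>\<sigma>'. whr\<^sup>*\<^sup>* (psubst \<sigma> u) (App (\<sigma> 0) (psubst \<sigma>' \<tau>))" if \<sigma>: "instantiates D \<sigma>" for \<sigma>
        proof -
          from step'[OF \<sigma>] obtain \<sigma>' where \<sigma>': "\<sigma>' 0 = \<sigma> 0" "instantiates (D @ D1) \<sigma>'"
            "whr\<^sup>*\<^sup>* (psubst \<sigma> u) (psubst \<sigma>' u1)"
            by (blast intro: tranclp_into_rtranclp)
          with \<tau>(3)[OF \<sigma>'(2)] show ?thesis by (metis rtranclp_trans)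
        qed
        with \<tau>(1,2) show ?thesis by blast
      qed
    next
      case (3 t)
      then show ?thesis using typing_Abs_inv[OF less.prems(2)] by (simp add: tyBot_def)
    qed
  qed
qed

text \<open>With instantiation excluded, every rule translates to itself, since the translation
  commutes with lifting and preserves free variables.\<close>

lemma typing_F0_goedel: "typing b \<Gamma> t A \<Longrightarrow> \<not> b \<Longrightarrow> typing True (map goedel \<Gamma>) t (goedel A)"
proof (induction rule: typing.induct)
  case (ax i \<Gamma> b)
  then show ?case using typing.ax[of i "map goedel \<Gamma>" True] by simp
next
  case (all_i A b \<Gamma> t)
  then show ?case by (auto simp: goedel_lift comp_def intro!: typing.all_i)
qed (auto intro: typing.intros proper_goedel)

theorem theorem4p3:
  assumes "input_type E"
    and "output_type S"
    and "1 \<notin> tcons S"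
    and "closed_term T"
    and "typF [] T (Arrow (goedel E) (neg (neg S)))"
  shows "storage_operator T E S"
  unfolding storage_operator_def
proof (intro allI impI)
  fix t assume t: "typF [] t E"
  obtain t\<^sub>0 where t\<^sub>0: "beta\<^sup>*\<^sup>* t t\<^sub>0" "normal t\<^sub>0"
    using wn_normal_form[OF typing_wn[OF t]] by blast
  then have t\<^sub>0_F0: "typF0 [] t\<^sub>0 E"
    using assms(1) t by (auto simp: input_type_def intro: beta_star_typing)
  have E: "proper E" "proper S" using assms(1,2) by (auto simp: input_type_def output_type_def)
  \<comment> \<open>\<open>Var 1\<close> stands for \<open>t\<^sub>0\<close>, whose closure has an
    empty environment because \<open>t\<^sub>0\<close> is closed.\<close>
  let ?\<Gamma> = "[neg S, goedel E]" and ?D = "[(t\<^sub>0, [])]" and ?u = "App (App T (Var 1)) (Var 0)"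
  have "wf_clos [neg S] t\<^sub>0 [] (goedel E)"
    unfolding wf_clos_def
    using t\<^sub>0_F0 E by (intro exI[of _ "[]"] exI[of _ E] exI[of _ TVar]) simp
  then have env: "wf_env ?\<Gamma> ?D" by (simp add: wf_env_def)
  have T: "typF \<Gamma> T (Arrow (goedel E) (Arrow (neg S) tyBot))" for \<Gamma>
    using typing_append[OF assms(5), of \<Gamma>] by (simp add: neg_def)
  have u: "typF ?\<Gamma> ?u tyBot"
    using typing.ax[of 0 ?\<Gamma> True] typing.ax[of 1 ?\<Gamma> True] T by (auto intro!: typing.arr_e)
  have psubst_T: "psubst \<sigma> T = T" for \<sigma>
    using psubst_cong[of T \<sigma> Var] assms(4) by (simp add: closed_term_def)
  have inst: "instantiates ?D (\<lambda>i. if i = 0 then s else \<theta>)" if "st \<theta> t\<^sub>0" for s \<theta>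
    unfolding instantiates_def realizes_def
    using that by (auto intro!: exI[of _ Var] exI[of _ \<theta>])
  \<comment> \<open>A general \<theta> need not be typable, so termination is measured on the run
    with \<open>t\<^sub>0\<close> itself, which is typable and hence has a bounded number of head
    steps.\<close>
  have "typF [neg S] t\<^sub>0 (goedel E)"
    using typing_append[OF typing_F0_goedel[OF t\<^sub>0_F0]] by simp
  then have "typF [neg S] (App (App T t\<^sub>0) (Var 0)) tyBot"
    using typing.ax[of 0 "[neg S]" True] T by (auto intro!: typing.arr_e)
  then obtain N where N: "whr_bound N (App (App T t\<^sub>0) (Var 0))"
    using typing_wn wn_whr_bound by blast
  obtain \<Gamma>' D' \<tau> where env': "wf_env (?\<Gamma> @ \<Gamma>') (?D @ D')" and \<tau>: "typF (?\<Gamma> @ \<Gamma>') \<tau> S"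
    and red: "\<And>\<sigma>. instantiates ?D \<sigma> \<Longrightarrow> \<exists>\<sigma>'. whr\<^sup>*\<^sup>* (psubst \<sigma> ?u) (App (\<sigma> 0) (psubst \<sigma>' \<tau>))"
    using head_reduction_to_output[OF env u _ inst[OF st_refl, of "Var 0"], of S N] N
    by (auto simp: psubst_T)
  obtain \<tau>' where \<tau>': "beta\<^sup>*\<^sup>* \<tau> \<tau>'" "normal \<tau>'"
    using wn_normal_form[OF typing_wn[OF \<tau>]] by blast
  have \<tau>'_S: "typF (?\<Gamma> @ \<Gamma>') \<tau>' S" using \<tau>'(1) \<tau> by (rule beta_star_typing)
  \<comment> \<open>Each variable of the final context has type \<open>neg S\<close> or an instance
    of a translated type; after \<open>rcon\<close>, both are inhabited by constant functions over
    \<alpha> : O.\<close>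
  have "\<exists>r. typF [tyO] (const_abs r 0) (rcon ((?\<Gamma> @ \<Gamma>') ! i))" if "i < length (?\<Gamma> @ \<Gamma>')" for i
  proof (cases i)
    case 0
    have "typF [tyO] (const_abs (Suc 0) 0) (Arrow (rcon S) tyO)"
      using E typing.ax[of 1 "[rcon S, tyO]" True] by (auto intro!: typing.arr_i)
    then have "typF [tyO] (const_abs (Suc 0) 0) (rcon ((?\<Gamma> @ \<Gamma>') ! i))"
      using 0 by (simp add: neg_def tyBot_def tyO_def)
    then show ?thesis by blast
  next
    case (Suc k)
    then have "k < length (?D @ D')" using that env' by (simp add: wf_env_def)
    then obtain \<Delta> b as where "wf_clos \<Delta> b as ((?\<Gamma> @ \<Gamma>') ! i)"
      using env' Suc unfolding wf_env_def by blast
    then obtain B \<rho> where "proper B" "\<And>i. proper (\<rho> i)" "(?\<Gamma> @ \<Gamma>') ! i = tsubst \<rho> (goedel B)"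
      unfolding wf_clos_def by blast
    then show ?thesis using const_abs_typing[of B \<rho> 0 "[tyO]"] by simp
  qed
  then have "typF [] \<tau>' S"
    using assms(2,3) \<tau>'_S \<tau>'(2) by (intro output_closed)
  moreover have "beta_eq \<tau> \<tau>'"
    unfolding beta_eq_def using \<tau>'(1) by (rule rtranclp_into_equivclp)
  moreover have "\<exists>\<sigma>. whr_star (App (App T \<theta>) (Var f)) (App (Var f) (psubst \<sigma> \<tau>))"
    if "beta_eq \<theta> t" for \<theta> f
  proof -
    \<comment> \<open>Standardization makes \<theta> a realization of the initial closure; the
      symbolic run is then instantiated with \<open>Var f\<close> for \<open>f\<close>.\<close>
    have "st \<theta> t\<^sub>0"
      by (rule beta_star_st[OF beta_eq_normal[OF that t\<^sub>0]])
    from red[OF inst[OF this, of "Var f"]] show ?thesis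
      by (simp add: psubst_T whr_star_def)
  qed
  ultimately show "\<exists>\<tau> \<tau>'. beta_eq \<tau> \<tau>' \<and> typF [] \<tau>' S \<and>
      (\<forall>\<theta> f. beta_eq \<theta> t \<longrightarrow> f \<notin> frees T \<longrightarrow> f \<notin> frees \<theta> \<longrightarrow>
        (\<exists>\<sigma>. whr_star (App (App T \<theta>) (Var f)) (App (Var f) (psubst \<sigma> \<tau>))))"
    by blast
qed

end
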